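(* Let $p,q>1$ satisfy $\frac1p+\frac1q=1$, and let $f,g\in C([0,1])$. Suppose that $\zeta_f^{(p)}\in\ell^p(\mathbb N_{-1})$, $\zeta_g^{(q)}\in\ell^q(\mathbb N_{-1})$, $H_f\in\ell^p(\mathbb N_0)$, and $H_g\in\ell^q(\mathbb N_0)$. Then the Faber--Schauder integral $I_{f,g}$ exists on $[0,1]$, and for every $0\le s\le\xi\le t\le1$ and every integer $N\ge0$ satisfying $t-s\le2^{-N}$, $$\bigg|\int_s^t f\,dg-f(\xi)\big(g(t)-g(s)\big)\bigg|\le 8L_f^{(p)}(N)L_g^{(q)}(N).$$ In particular, taking $N=0$ gives $$\bigg|\int_s^t f\,dg-f(\xi)\big(g(t)-g(s)\big)\bigg|\le 8L_f^{(p)}(0)L_g^{(q)}(0),\qquad 0\le s\le\xi\le t\le1.$$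
   Context: $C([0,1])$ denotes the real-valued continuous functions on $[0,1]$. $\mathbb N_0=\{0,1,2,\dots\}$, $\mathbb N_{-1}=\{-1,0,1,\dots\}$. For $n\in\mathbb N_0$: $t_{n,k}=k2^{-n}$ for $0\le k\le 2^n$, $\mathbb T_n=\{t_{n,k}:0\le k\le 2^n\}$, $\mathbb T=\bigcup_{n\ge0}\mathbb T_n$, $I_n=\{0,\dots,2^n-1\}$; for $t\in\mathbb T$, $\ell(t)=\min\{m\ge0:t\in\mathbb T_m\}$. Dyadic left sums: for $f,g\in C([0,1])$, $t\in\mathbb T$, $n\ge\ell(t)$, $$S_n^L(t;f,g)=\sum_{k=0}^{2^nt-1}f(t_{n,k})\big(g(t_{n,k+1})-g(t_{n,k})\big)$$ (empty sum $=0$). The dyadic integral over $[0,t]$ exists if $(S_n^L(t;f,g))_{n\ge\ell(t)}$ converges, and its limit is denoted $I^{\mathbb T}_{f,g}(t)$. Faber--Schauder integral: if $I^{\mathbb T}_{f,g}(t)$ exists for every $t\in\mathbb T$ and the map $I^{\mathbb T}_{f,g}:\mathbb T\to\mathbb R$ admits a (necessarily unique) continuous extension to $[0,1]$, this extension is denoted $I_{f,g}:[0,1]\to\mathbb R$ and one says that the Faber--Schauder integral $I_{f,g}$ exists on $[0,1]$. In that case $\int_s^t f\,dg:=I_{f,g}(t)-I_{f,g}(s)$ for all $s,t\in[0,1]$. Faber--Schauder coefficients of $f\in C([0,1])$: $\theta^f_{-1,0}=f(1)-f(0)$, and for $n\ge0$, $k\in I_n$, $\theta^f_{n,k}=2^{n/2}\big(2f(t_{n+1,2k+1})-f(t_{n,k})-f(t_{n,k+1})\big)$.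 Level energies ($p>1$): $\zeta_f^{(p)}(-1)=2^{1-\frac1p}|\theta^f_{-1,0}|$ and $\zeta_f^{(p)}(n)=\big(2^{-np/2}\sum_{k\in I_n}|\theta^f_{n,k}|^p\big)^{1/p}$ for $n\ge0$. Schauder tail sequence: $H_f(n)=\sum_{m=n}^\infty 2^{-m/2}\sup_{k\in I_m}|\theta^f_{m,k}|\in[0,\infty]$ for $n\ge0$. For $r>1$ and $h\in C([0,1])$: $\mathcal A_h^{(r)}(n)=\sum_{m=-1}^n 2^{-(n-m)(1-\frac1r)}\zeta_h^{(r)}(m)$ for $n\ge0$, and $$L_h^{(r)}(N)=\|\mathcal A_h^{(r)}\|_{\ell^r_{\ge N}}+\tfrac12\|H_h\|_{\ell^r_{\ge N}},\qquad \|a\|_{\ell^r_{\ge N}}:=\Big(\sum_{n=N}^\infty|a_n|^r\Big)^{1/r},\qquad N\ge0.$$ *)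

theory Defs
  imports "HOL-Analysis.Analysis"
begin

definition dyadic_point :: "nat \<Rightarrow> nat \<Rightarrow> real" where
  "dyadic_point n k = real k / 2 ^ n"

definition dyadic_level :: "nat \<Rightarrow> real set" where
  "dyadic_level n = dyadic_point n ` {0..2 ^ n}"

definition dyadic_points :: "real set" where
  "dyadic_points = (\<Union>n. dyadic_level n)"

definition level :: "real \<Rightarrow> nat" where
  "level t = (LEAST m. t \<in> dyadic_level m)"

text \<open>Used only for \<open>t\<close> dyadic and \<open>n \<ge> level t\<close>, where \<open>2 ^ n * t\<close> is a
  natural number and the floor does nothing.\<close>

definition left_sum :: "(real \<Rightarrow> real) \<Rightarrow> (real \<Rightarrow> real) \<Rightarrow> nat \<Rightarrow> real \<Rightarrow> real" where
  "left_sum f g n t =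
     (\<Sum>k<nat \<lfloor>2 ^ n * t\<rfloor>.
        f (dyadic_point n k) * (g (dyadic_point n (k + 1)) - g (dyadic_point n k)))"

text \<open>The sequence of left sums over \<open>n \<ge> level t\<close> is reindexed to start at \<open>0\<close>.\<close>

definition dyadic_integrable :: "(real \<Rightarrow> real) \<Rightarrow> (real \<Rightarrow> real) \<Rightarrow> real \<Rightarrow> bool" where
  "dyadic_integrable f g t \<longleftrightarrow> convergent (\<lambda>j. left_sum f g (level t + j) t)"

definition dyadic_integral :: "(real \<Rightarrow> real) \<Rightarrow> (real \<Rightarrow> real) \<Rightarrow> real \<Rightarrow> real" where
  "dyadic_integral f g t = lim (\<lambda>j. left_sum f g (level t + j) t)"

definition is_FS_integral ::
    "(real \<Rightarrow> real) \<Rightarrow> (real \<Rightarrow> real) \<Rightarrow> (real \<Rightarrow> real) \<Rightarrow> bool" where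
  "is_FS_integral f g I \<longleftrightarrow>
     (\<forall>t\<in>dyadic_points. dyadic_integrable f g t) \<and>
     continuous_on {0..1} I \<and> (\<forall>t\<in>dyadic_points. I t = dyadic_integral f g t)"

definition FS_integrable :: "(real \<Rightarrow> real) \<Rightarrow> (real \<Rightarrow> real) \<Rightarrow> bool" where
  "FS_integrable f g \<longleftrightarrow> (\<exists>I. is_FS_integral f g I)"

text \<open>Only the values on \<open>{0..1}\<close> are meaningful; there the choice is unique, see
  \<open>is_FS_integral_unique\<close> below.\<close>

definition FS_integral :: "(real \<Rightarrow> real) \<Rightarrow> (real \<Rightarrow> real) \<Rightarrow> real \<Rightarrow> real" where
  "FS_integral f g = (SOME I. is_FS_integral f g I)"

definition FS_int_between ::
    "(real \<Rightarrow> real) \<Rightarrow> (real \<Rightarrow> real) \<Rightarrow> real \<Rightarrow> real \<Rightarrow> real" where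
  "FS_int_between f g s t = FS_integral f g t - FS_integral f g s"

lemma dyadic_points_dense:
  assumes "x \<in> {0..1}"
  shows "x \<in> closure dyadic_points"
proof -
  define u where "u n = dyadic_point n (nat \<lfloor>2 ^ n * x\<rfloor>)" for n
  have nn: "real (nat \<lfloor>2 ^ n * x\<rfloor>) = of_int \<lfloor>2 ^ n * x\<rfloor>" for n
    using assms by (simp add: of_nat_nat)
  have "u n \<in> dyadic_points" for n
  proof -
    have "2 ^ n * x \<le> 2 ^ n * 1"
      using assms by (intro mult_left_mono) auto
    then have "real (nat \<lfloor>2 ^ n * x\<rfloor>) \<le> real (2 ^ n)"
      unfolding nn of_nat_power of_nat_numeral mult_1_right
      using of_int_floor_le[of "2 ^ n * x"] by (rule order_trans[rotated])
    then have "nat \<lfloor>2 ^ n * x\<rfloor> \<le> 2 ^ n"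
      unfolding of_nat_le_iff .
    then have "nat \<lfloor>2 ^ n * x\<rfloor> \<in> {0..2 ^ n}" by (simp only: atLeastAtMost_iff le0 simp_thms)
    then show ?thesis
      unfolding u_def dyadic_points_def dyadic_level_def by blast
  qed
  moreover have "u \<longlonglongrightarrow> x"
  proof (rule tendsto_sandwich)
    show "\<forall>\<^sub>F n in sequentially. x - (1 / 2) ^ n \<le> u n"
    proof (intro always_eventually allI)
      fix n
      have "2 ^ n * x - 1 \<le> of_int \<lfloor>2 ^ n * x\<rfloor>" by linarith
      then have "(2 ^ n * x - 1) / 2 ^ n \<le> of_int \<lfloor>2 ^ n * x\<rfloor> / 2 ^ n"
        by (intro divide_right_mono) auto
      then show "x - (1 / 2) ^ n \<le> u n"
        unfolding u_def dyadic_point_def nn by (simp add: diff_divide_distrib power_divide)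
    qed
    show "\<forall>\<^sub>F n in sequentially. u n \<le> x"
      unfolding u_def dyadic_point_def nn
      by (intro always_eventually allI) (simp add: divide_le_eq mult.commute)
    have "(\<lambda>n. x - (1 / 2) ^ n) \<longlonglongrightarrow> x - 0"
      by (intro tendsto_diff tendsto_const LIMSEQ_power_zero) auto
    then show "(\<lambda>n. x - (1 / 2) ^ n) \<longlonglongrightarrow> x" by simp
  qed auto
  ultimately show ?thesis
    unfolding closure_sequential by blast
qed

lemma dyadic_points_subset: "dyadic_points \<subseteq> {0..1}"
proof -
  have "real k / 2 ^ n \<le> 1" if "k \<le> 2 ^ n" for k n :: nat
  proof -
    have "real k \<le> real (2 ^ n)"
      using that by (simp only: of_nat_le_iff)
    then show ?thesis by simp
  qed
  then show ?thesis
    by (auto simp: dyadic_points_def dyadic_level_def dyadic_point_def)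
qed

lemma is_FS_integral_unique:
  assumes "is_FS_integral f g I" "is_FS_integral f g J" "x \<in> {0..1}"
  shows "I x = J x"
proof -
  have cl: "closure dyadic_points = {0..1}"
    using dyadic_points_dense closure_minimal[OF dyadic_points_subset closed_atLeastAtMost]
    by (intro subset_antisym subsetI) blast+
  have "continuous_on (closure dyadic_points) (\<lambda>x. I x - J x)"
    using assms unfolding cl is_FS_integral_def by (intro continuous_on_diff) auto
  moreover have "I t - J t = 0" if "t \<in> dyadic_points" for t
    using assms that unfolding is_FS_integral_def by auto
  moreover have "x \<in> closure dyadic_points"
    using assms(3) cl by simp
  ultimately have "I x - J x = 0"
    by (rule continuous_constant_on_closure[where f = "\<lambda>x. I x - J x"])
  then show ?thesis by simp
qed

text \<open>Level \<open>-1\<close> is why the level index is an integer; values at levels below \<open>-1\<close>, and at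
  positions other than \<open>0\<close> on level \<open>-1\<close>, are never used.\<close>

definition schauder_coeff :: "(real \<Rightarrow> real) \<Rightarrow> int \<Rightarrow> nat \<Rightarrow> real" where
  "schauder_coeff f n k =
     (if n = -1 then f 1 - f 0
      else 2 powr (real_of_int n / 2) *
        (2 * f (dyadic_point (nat n + 1) (2 * k + 1))
           - f (dyadic_point (nat n) k) - f (dyadic_point (nat n) (k + 1))))"

definition level_energy :: "real \<Rightarrow> (real \<Rightarrow> real) \<Rightarrow> int \<Rightarrow> real" where
  "level_energy p f n =
     (if n = -1 then 2 powr (1 - 1 / p) * \<bar>schauder_coeff f (-1) 0\<bar>
      else (2 powr (- (real_of_int n * p / 2)) *
        (\<Sum>k<2 ^ nat n. \<bar>schauder_coeff f n k\<bar> powr p)) powr (1 / p))"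

definition schauder_tail :: "(real \<Rightarrow> real) \<Rightarrow> nat \<Rightarrow> ennreal" where
  "schauder_tail f n =
     (\<Sum>\<^sub>\<infinity>m\<in>{n..}. ennreal (2 powr (- (real m / 2)) *
        (SUP k\<in>{..<2 ^ m}. \<bar>schauder_coeff f (int m) k\<bar>)))"

text \<open>Real powers of extended nonnegative numbers, for exponents \<open>r > 0\<close>.\<close>

definition ennreal_powr :: "ennreal \<Rightarrow> real \<Rightarrow> ennreal" where
  "ennreal_powr x r = (if x = \<infinity> then \<infinity> else ennreal (enn2real x powr r))"

definition lp_norm :: "'i set \<Rightarrow> real \<Rightarrow> ('i \<Rightarrow> ennreal) \<Rightarrow> ennreal" where
  "lp_norm A r a = ennreal_powr (\<Sum>\<^sub>\<infinity>i\<in>A. ennreal_powr (a i) r) (1 / r)"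

definition in_lp :: "'i set \<Rightarrow> real \<Rightarrow> ('i \<Rightarrow> ennreal) \<Rightarrow> bool" where
  "in_lp A r a \<longleftrightarrow> lp_norm A r a < \<infinity>"

definition energy_average :: "real \<Rightarrow> (real \<Rightarrow> real) \<Rightarrow> nat \<Rightarrow> real" where
  "energy_average r h n =
     (\<Sum>m\<in>{-1..int n}. 2 powr (- (real n - real_of_int m) * (1 - 1 / r)) * level_energy r h m)"

definition FS_bound :: "real \<Rightarrow> (real \<Rightarrow> real) \<Rightarrow> nat \<Rightarrow> ennreal" where
  "FS_bound r h N =
     lp_norm {N..} r (\<lambda>n. ennreal \<bar>energy_average r h n\<bar>)
       + lp_norm {N..} r (schauder_tail h) / 2"

end

theory Submission
  imports Defs
begin

text \<open>For each function \<open>h\<close> with its exponent \<open>r\<close>, a single sequence carries all the information: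
  \<open>oscillation_bound r h n\<close>, the energy average at level \<open>n\<close> plus half the Schauder tail. It
  bounds two different things at level \<open>n\<close>.

  First, the \<open>\<ell>\<^sup>r\<close> norms of the increments of \<open>h\<close> over the dyadic grids of levels \<open>n\<close> and
  \<open>n + 1\<close>. The two halves of an interval have increments equal to half of the whole increment plus
  or minus half of a second difference, so Minkowski's inequality gives a recursion for these norms
  (\<open>increment_norm_step\<close>). It bounds the norm plus the energy of the level by the energy average,
  which satisfies the same recursion with equality. Secondly, the distance between \<open>h(x)\<close> and the
  value of \<open>h\<close> at either endpoint of a level \<open>n\<close> interval around \<open>x\<close>: the secant moves by at
  most one increment, and half the Schauder tail bounds the distance from \<open>h\<close> to its piecewise
  linear interpolation (\<open>interpolation_error_tail\<close>).

  Let \<open>x\<^sub>n\<close> be \<open>x\<close> rounded down to level \<open>n\<close>. Refining a left sum by one level adds products of an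
  increment of \<open>f\<close> over a left half and an increment of \<open>g\<close> over the adjacent right half, which
  Hoelder's inequality controls, and, if \<open>x\<close> is not yet on the grid, a boundary term
  \<open>f(x\<^sub>n) (g(x\<^sub>n\<^sub>+\<^sub>1) - g(x\<^sub>n))\<close>. The boundary terms need not be absolutely summable over \<open>n\<close>, but they
  are with \<open>f(x\<^sub>n) - f(x)\<close> in place of \<open>f(x\<^sub>n)\<close>, and the difference
  \<open>f(x) (g(x\<^sub>n\<^sub>+\<^sub>1) - g(x\<^sub>n))\<close> telescopes. Hence the left sums converge at every \<open>x\<close> in \<open>[0, 1]\<close>, not
  only at dyadic ones.

  Let \<open>B\<close> and \<open>C\<close> be the oscillation bounds of \<open>f\<close> and \<open>g\<close>. Comparing the endpoints \<open>s\<close> and \<open>t\<close>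
  costs three terms \<open>B\<^sub>n C\<^sub>n\<close> for each level from \<open>N\<close> on; on level \<open>N\<close> itself the two roundings are at
  most one grid step apart, and an explicit decomposition costs \<open>5 B\<^sub>N C\<^sub>N\<close>. Together this
  is at most \<open>8 \<Sum>\<^sub>n\<^sub>\<ge>\<^sub>N B\<^sub>n C\<^sub>n\<close> (\<open>primitive_estimate\<close>). The same estimate shows that the
  limit is continuous, so it is the Faber--Schauder integral, and the inequalities of Hoelder and
  Minkowski in the level index bound the sum by the product of the two norm expressions.\<close>

section \<open>Hoelder and Minkowski inequalities for finite families\<close>

text \<open>If \<open>x\<close> or \<open>y\<close> is \<open>0\<close>, the inequality reduces to \<open>v powr p \<le> v\<close> for \<open>v\<close> in \<open>[0, 1]\<close>.\<close>

lemma powr_two_point_convex: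
  fixes x y u p :: real
  assumes "1 < p" "0 \<le> x" "0 \<le> y" "0 \<le> u" "u \<le> 1"
  shows "(u * x + (1 - u) * y) powr p \<le> u * x powr p + (1 - u) * y powr p"
proof -
  have shrink: "(v * z) powr p \<le> v * z powr p" if "0 \<le> v" "v \<le> 1" "0 \<le> z" for v z
  proof -
    have "v powr p \<le> v powr 1" if "0 < v"
      using that \<open>v \<le> 1\<close> assms(1) by (intro powr_mono') auto
    then have "v powr p \<le> v"
      using that by (cases "v = 0") auto
    then have "v powr p * z powr p \<le> v * z powr p"
      by (intro mult_right_mono) auto
    then show ?thesis
      using that by (simp add: powr_mult)
  qed
  consider "x = 0" | "y = 0" | "0 < x" "0 < y"
    using assms by linarith
  then show ?thesis
  proof cases
    case 1
    then show ?thesis using shrink[of "1 - u" y] assms by simp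
  next
    case 2
    then show ?thesis using shrink[of u x] assms by simp
  next
    case 3
    then show ?thesis
      using convex_onD[OF powr_convex[of p], of "1 - u" x y] assms by simp
  qed
qed

definition finite_lp_norm :: "real \<Rightarrow> 'i set \<Rightarrow> ('i \<Rightarrow> real) \<Rightarrow> real" where
  "finite_lp_norm p F a = (\<Sum>i\<in>F. \<bar>a i\<bar> powr p) powr (1 / p)"

lemma finite_lp_norm_nonneg [simp]: "0 \<le> finite_lp_norm p F a"
  by (simp add: finite_lp_norm_def)

lemma finite_lp_norm_powr:
  assumes "1 < p"
  shows "finite_lp_norm p F a powr p = (\<Sum>i\<in>F. \<bar>a i\<bar> powr p)"
  using assms by (simp add: finite_lp_norm_def powr_powr sum_nonneg)

lemma finite_lp_norm_leI:
  assumes "1 < p" "0 \<le> c" "(\<Sum>i\<in>F. \<bar>a i\<bar> powr p) \<le> c powr p"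
  shows "finite_lp_norm p F a \<le> c"
proof -
  have "finite_lp_norm p F a \<le> (c powr p) powr (1 / p)"
    unfolding finite_lp_norm_def using assms by (intro powr_mono2 sum_nonneg) auto
  then show ?thesis using assms by (simp add: powr_powr)
qed

lemma finite_lp_norm_mono:
  assumes "1 < p" "finite G" "F \<subseteq> G" "\<And>i. i \<in> F \<Longrightarrow> \<bar>a i\<bar> \<le> \<bar>b i\<bar>"
  shows "finite_lp_norm p F a \<le> finite_lp_norm p G b"
proof -
  have "(\<Sum>i\<in>F. \<bar>a i\<bar> powr p) \<le> (\<Sum>i\<in>F. \<bar>b i\<bar> powr p)"
    using assms by (intro sum_mono powr_mono2) auto
  also have "\<dots> \<le> (\<Sum>i\<in>G. \<bar>b i\<bar> powr p)"
    using assms by (intro sum_mono2) auto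
  finally show ?thesis
    unfolding finite_lp_norm_def using assms by (intro powr_mono2 sum_nonneg) auto
qed

lemma component_le_finite_lp_norm:
  assumes "1 < p" "finite F" "i \<in> F"
  shows "\<bar>a i\<bar> \<le> finite_lp_norm p F a"
  using finite_lp_norm_mono[of p F "{i}" a a] assms
  by (simp add: finite_lp_norm_def powr_powr)

lemma finite_lp_norm_eq_0D:
  assumes "1 < p" "finite F" "finite_lp_norm p F a = 0" "i \<in> F"
  shows "a i = 0"
  using component_le_finite_lp_norm[OF assms(1,2,4), of a] assms(3) by simp

text \<open>Young's inequality is applied to the families divided by their norms.\<close>

lemma finite_holder:
  assumes pq: "1 < p" "1 < q" "1 / p + 1 / q = 1" and F: "finite F"
  shows "(\<Sum>i\<in>F. \<bar>a i\<bar> * \<bar>b i\<bar>) \<le> finite_lp_norm p F a * finite_lp_norm q F b"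
proof -
  let ?A = "finite_lp_norm p F a" and ?B = "finite_lp_norm q F b"
  consider "?A = 0" | "?B = 0" | "0 < ?A" "0 < ?B"
    using finite_lp_norm_nonneg[of p F a] finite_lp_norm_nonneg[of q F b] by linarith
  then show ?thesis
  proof cases
    case 1
    then show ?thesis using finite_lp_norm_eq_0D[OF pq(1) F 1] by simp
  next
    case 2
    then show ?thesis using finite_lp_norm_eq_0D[OF pq(2) F 2] by simp
  next
    case 3
    have "(\<Sum>i\<in>F. \<bar>a i\<bar> / ?A * (\<bar>b i\<bar> / ?B))
        \<le> (\<Sum>i\<in>F. (\<bar>a i\<bar> / ?A) powr p / p + (\<bar>b i\<bar> / ?B) powr q / q)"
      using 3 pq by (intro sum_mono Youngs_inequality) auto
    also have "\<dots> = (\<Sum>i\<in>F. \<bar>a i\<bar> powr p) / ?A powr p / p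
        + (\<Sum>i\<in>F. \<bar>b i\<bar> powr q) / ?B powr q / q"
      using 3 by (simp add: sum.distrib powr_divide sum_divide_distrib)
    also have "\<dots> = 1"
      using 3 pq by (simp flip: finite_lp_norm_powr)
    finally have "(\<Sum>i\<in>F. \<bar>a i\<bar> * \<bar>b i\<bar>) / (?A * ?B) \<le> 1"
      by (simp add: sum_divide_distrib)
    then show ?thesis
      using 3 by (simp add: divide_le_eq)
  qed
qed

text \<open>Write \<open>S\<close> for the sum of the two norms. Then \<open>(a + b) / S\<close> is a convex combination of the two
  normalised families, and convexity of the power bounds its power sum by \<open>1\<close>.\<close>

lemma finite_minkowski:
  assumes p: "1 < p" and F: "finite F"
  shows "finite_lp_norm p F (\<lambda>i. a i + b i) \<le> finite_lp_norm p F a + finite_lp_norm p F b"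
proof -
  let ?A = "finite_lp_norm p F a" and ?B = "finite_lp_norm p F b"
  consider "?A = 0" | "?B = 0" | "0 < ?A" "0 < ?B"
    using finite_lp_norm_nonneg[of p F a] finite_lp_norm_nonneg[of p F b] by linarith
  then show ?thesis
  proof cases
    case 1
    then show ?thesis
      using finite_lp_norm_eq_0D[OF p F 1] by (simp add: finite_lp_norm_def)
  next
    case 2
    then show ?thesis
      using finite_lp_norm_eq_0D[OF p F 2] by (simp add: finite_lp_norm_def)
  next
    case 3
    define S where "S = ?A + ?B"
    define u where "u = ?A / S"
    have S: "0 < S" and u: "0 \<le> u" "u \<le> 1" "1 - u = ?B / S"
      using 3 by (auto simp: S_def u_def field_simps)
    have pt: "\<bar>a i + b i\<bar> powr p
        \<le> S powr p * (u * (\<bar>a i\<bar> / ?A) powr p + (1 - u) * (\<bar>b i\<bar> / ?B) powr p)" for i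
    proof -
      have "\<bar>a i + b i\<bar> \<le> S * (u * (\<bar>a i\<bar> / ?A) + (1 - u) * (\<bar>b i\<bar> / ?B))"
        using 3 S by (simp add: u(3) distrib_left) (simp add: u_def)
      then have "\<bar>a i + b i\<bar> powr p
          \<le> (S * (u * (\<bar>a i\<bar> / ?A) + (1 - u) * (\<bar>b i\<bar> / ?B))) powr p"
        using p by (intro powr_mono2) auto
      also have "\<dots> = S powr p * (u * (\<bar>a i\<bar> / ?A) + (1 - u) * (\<bar>b i\<bar> / ?B)) powr p"
        using S u(1,2) by (intro powr_mult)
      also have "\<dots> \<le> S powr p * (u * (\<bar>a i\<bar> / ?A) powr p + (1 - u) * (\<bar>b i\<bar> / ?B) powr p)"
        using 3 p u by (intro mult_left_mono powr_two_point_convex) auto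
      finally show ?thesis .
    qed
    have "(\<Sum>i\<in>F. \<bar>a i + b i\<bar> powr p)
        \<le> (\<Sum>i\<in>F. S powr p * (u * (\<bar>a i\<bar> / ?A) powr p + (1 - u) * (\<bar>b i\<bar> / ?B) powr p))"
      by (intro sum_mono pt)
    also have "\<dots> = S powr p * (u * ((\<Sum>i\<in>F. \<bar>a i\<bar> powr p) / ?A powr p)
        + (1 - u) * ((\<Sum>i\<in>F. \<bar>b i\<bar> powr p) / ?B powr p))"
      using 3
      by (simp add: sum.distrib powr_divide sum_divide_distrib sum_distrib_left distrib_left)
    also have "\<dots> = S powr p"
      using 3 p by (simp flip: finite_lp_norm_powr)
    finally show ?thesis
      unfolding S_def[symmetric] using p S by (intro finite_lp_norm_leI) auto
  qed
qed

lemma finite_lp_norm_half: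
  assumes "1 < p"
  shows "finite_lp_norm p F (\<lambda>i. a i / 2) = finite_lp_norm p F a / 2"
proof -
  have "(\<Sum>i\<in>F. \<bar>a i / 2\<bar> powr p) = (1 / 2) powr p * (\<Sum>i\<in>F. \<bar>a i\<bar> powr p)"
    by (simp add: sum_distrib_left powr_divide)
  then show ?thesis
    using assms by (simp add: finite_lp_norm_def powr_mult sum_nonneg powr_powr)
qed

section \<open>Increments on the dyadic grids\<close>

definition dyadic_increment :: "(real \<Rightarrow> real) \<Rightarrow> nat \<Rightarrow> nat \<Rightarrow> real" where
  "dyadic_increment f n k = f (dyadic_point n (k + 1)) - f (dyadic_point n k)"

text \<open>This is the Schauder coefficient without its factor \<open>2\<^bsup>n/2\<^esup>\<close>; the level energy is then a plain
  \<open>\<ell>\<^sup>p\<close> norm.\<close>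

definition second_difference :: "(real \<Rightarrow> real) \<Rightarrow> nat \<Rightarrow> nat \<Rightarrow> real" where
  "second_difference f n k =
     2 * f (dyadic_point (n + 1) (2 * k + 1)) - f (dyadic_point n k) - f (dyadic_point n (k + 1))"

lemma dyadic_point_double [simp]: "dyadic_point (Suc n) (2 * k) = dyadic_point n k"
  by (simp add: dyadic_point_def)

lemma dyadic_point_double_Suc [simp]: "dyadic_point (Suc n) (Suc (Suc (2 * k))) = dyadic_point n (Suc k)"
  by (simp add: dyadic_point_def field_simps)

lemma schauder_coeff_eq: "schauder_coeff f (int n) k = 2 powr (real n / 2) * second_difference f n k"
  by (simp add: schauder_coeff_def second_difference_def)

lemma level_energy_eq:
  assumes "1 < p"
  shows "level_energy p f (int n) = finite_lp_norm p {..<2 ^ n} (second_difference f n)"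
proof -
  have "2 powr (- (real n * p / 2)) * \<bar>schauder_coeff f (int n) k\<bar> powr p
      = \<bar>second_difference f n k\<bar> powr p" for k
    unfolding schauder_coeff_eq
    by (simp add: abs_mult powr_mult powr_powr flip: mult.assoc powr_add)
  then show ?thesis
    by (simp add: level_energy_def finite_lp_norm_def sum_distrib_left)
qed

lemma sum_double_lessThan:
  fixes F :: "nat \<Rightarrow> 'a::comm_monoid_add"
  shows "(\<Sum>j<2 * N. F j) = (\<Sum>k<N. F (2 * k) + F (2 * k + 1))"
  by (induction N) (simp_all add: add.assoc)

text \<open>Halving each entry and using it twice scales the norm by \<open>(2 \<cdot> 2\<^bsup>-p\<^esup>)\<^bsup>1/p\<^esup>\<close>: this is where the
  damping factor of the energy average comes from.\<close>

lemma finite_lp_norm_halved_pairs: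
  fixes c d :: "nat \<Rightarrow> real"
  assumes p: "1 < p" and c: "\<And>j. \<bar>c j\<bar> = \<bar>d (j div 2)\<bar> / 2"
  shows "finite_lp_norm p {..<2 * N} c = 2 powr (1 / p - 1) * finite_lp_norm p {..<N} d"
proof -
  have "(\<Sum>j<2 * N. \<bar>c j\<bar> powr p) = (\<Sum>k<N. 2 powr (1 - p) * \<bar>d k\<bar> powr p)"
    unfolding sum_double_lessThan c
    by (intro sum.cong) (simp_all add: powr_divide powr_diff)
  also have "\<dots> = 2 powr (1 - p) * (\<Sum>k<N. \<bar>d k\<bar> powr p)"
    by (simp add: sum_distrib_left)
  finally have "finite_lp_norm p {..<2 * N} c
      = (2 powr (1 - p)) powr (1 / p) * (\<Sum>k<N. \<bar>d k\<bar> powr p) powr (1 / p)"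
    by (simp add: finite_lp_norm_def powr_mult sum_nonneg)
  also have "(2 powr (1 - p)) powr (1 / p) = 2 powr (1 / p - 1)"
    using p by (simp add: powr_powr diff_divide_distrib)
  finally show ?thesis
    by (simp add: finite_lp_norm_def)
qed

text \<open>The increments over the two halves of an interval are half the increment over the interval,
  plus (left) or minus (right) half the second difference at its midpoint.\<close>

lemma increment_norm_step:
  assumes p: "1 < p"
  shows "finite_lp_norm p {..<2 ^ Suc n} (dyadic_increment f (Suc n))
    \<le> 2 powr (1 / p - 1) *
      (finite_lp_norm p {..<2 ^ n} (dyadic_increment f n) + level_energy p f (int n))"
proof -
  define a where "a j = dyadic_increment f n (j div 2) / 2" for j
  define b where "b j = (if even j then 1 else - 1) * second_difference f n (j div 2) / 2" for j
  have ab: "dyadic_increment f (Suc n) j = a j + b j" for j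
  proof (cases "even j")
    case True
    then obtain k where "j = 2 * k" by (elim evenE)
    then show ?thesis
      by (simp add: a_def b_def dyadic_increment_def second_difference_def diff_divide_distrib)
  next
    case False
    then obtain k where "j = 2 * k + 1" by (elim oddE)
    then show ?thesis
      by (simp add: a_def b_def dyadic_increment_def second_difference_def diff_divide_distrib)
  qed
  have na: "finite_lp_norm p {..<2 * 2 ^ n} a
      = 2 powr (1 / p - 1) * finite_lp_norm p {..<2 ^ n} (dyadic_increment f n)"
    by (intro finite_lp_norm_halved_pairs p) (simp add: a_def)
  have nb: "finite_lp_norm p {..<2 * 2 ^ n} b
      = 2 powr (1 / p - 1) * finite_lp_norm p {..<2 ^ n} (second_difference f n)"
    by (intro finite_lp_norm_halved_pairs p) (simp add: b_def abs_mult)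
  have "finite_lp_norm p {..<2 ^ Suc n} (dyadic_increment f (Suc n))
      = finite_lp_norm p {..<2 * 2 ^ n} (\<lambda>j. a j + b j)"
    by (simp add: ab[abs_def] finite_lp_norm_def)
  also have "\<dots> \<le> finite_lp_norm p {..<2 * 2 ^ n} a + finite_lp_norm p {..<2 * 2 ^ n} b"
    by (intro finite_minkowski p) simp
  finally show ?thesis
    by (simp add: na nb level_energy_eq[OF p] distrib_left)
qed

lemma level_energy_nonneg [simp]: "0 \<le> level_energy p f m"
  by (simp add: level_energy_def)

lemma energy_average_nonneg [simp]: "0 \<le> energy_average p f n"
  by (simp add: energy_average_def sum_nonneg)

lemma energy_average_0:
  "energy_average p f 0 = 2 powr (1 / p - 1) * level_energy p f (- 1) + level_energy p f 0"
proof -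
  have "{-1..int 0} = {-1, 0}" by auto
  then show ?thesis by (simp add: energy_average_def)
qed

lemma energy_average_Suc:
  "energy_average p f (Suc n)
    = 2 powr (1 / p - 1) * energy_average p f n + level_energy p f (int (Suc n))"
proof -
  have levels: "{-1..int (Suc n)} = insert (int (Suc n)) {-1..int n}" by auto
  have weight: "2 powr (- (real (Suc n) - real_of_int m) * (1 - 1 / p))
      = 2 powr (1 / p - 1) * 2 powr (- (real n - real_of_int m) * (1 - 1 / p))" for m
    by (simp add: algebra_simps flip: powr_add)
  have "energy_average p f (Suc n)
      = 2 powr (- (real (Suc n) - real_of_int (int (Suc n))) * (1 - 1 / p)) * level_energy p f (int (Suc n))
        + (\<Sum>m\<in>{-1..int n}.
            2 powr (- (real (Suc n) - real_of_int m) * (1 - 1 / p)) * level_energy p f m)"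
    unfolding energy_average_def levels by (rule sum.insert) auto
  also have "(\<Sum>m\<in>{-1..int n}.
            2 powr (- (real (Suc n) - real_of_int m) * (1 - 1 / p)) * level_energy p f m)
      = 2 powr (1 / p - 1) * energy_average p f n"
    unfolding energy_average_def sum_distrib_left weight mult.assoc ..
  finally show ?thesis by simp
qed

text \<open>The left side satisfies as an inequality the recursion in \<open>n\<close> that the right side satisfies with
  equality, and at \<open>n = 0\<close> they agree: the factor \<open>2\<^bsup>1 - 1/p\<^esup>\<close> in the energy of level \<open>-1\<close>
  cancels the damping of one level.\<close>

lemma increment_norm_plus_energy_le:
  assumes p: "1 < p"
  shows "finite_lp_norm p {..<2 ^ n} (dyadic_increment f n) + level_energy p f (int n)
    \<le> energy_average p f n"
proof (induction n)
  case 0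
  have "2 powr (1 / p - 1) * level_energy p f (- 1) = \<bar>f 1 - f 0\<bar>"
    by (simp add: level_energy_def schauder_coeff_def flip: mult.assoc powr_add)
  moreover have "finite_lp_norm p {..<2 ^ 0} (dyadic_increment f 0) = \<bar>f 1 - f 0\<bar>"
    using p by (simp add: finite_lp_norm_def dyadic_increment_def dyadic_point_def powr_powr)
  ultimately show ?case
    by (simp add: energy_average_0)
next
  case (Suc n)
  have "finite_lp_norm p {..<2 ^ Suc n} (dyadic_increment f (Suc n))
      \<le> 2 powr (1 / p - 1) * energy_average p f n"
    using increment_norm_step[OF p, of n f] mult_left_mono[OF Suc powr_ge_zero, of 2 "1 / p - 1"]
    by linarith
  then show ?case
    by (simp add: energy_average_Suc)
qed

lemma increment_norm_le:
  assumes p: "1 < p"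
  shows "finite_lp_norm p {..<2 ^ n} (dyadic_increment f n) \<le> energy_average p f n"
  using increment_norm_plus_energy_le[OF p, of n f] level_energy_nonneg[of p f "int n"] by linarith

lemma increment_norm_Suc_le:
  assumes p: "1 < p"
  shows "finite_lp_norm p {..<2 ^ Suc n} (dyadic_increment f (Suc n)) \<le> energy_average p f n"
proof -
  have "2 powr (1 / p - 1) \<le> 2 powr (0::real)"
    using p by (intro powr_mono) auto
  then have "2 powr (1 / p - 1) * energy_average p f n \<le> 1 * energy_average p f n"
    by (intro mult_right_mono) auto
  then show ?thesis
    using increment_norm_step[OF p, of n f]
      mult_left_mono[OF increment_norm_plus_energy_le[OF p, of n f] powr_ge_zero, of 2 "1 / p - 1"]
    by linarith
qed

section \<open>Rounding down to the dyadic grids\<close>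

definition dyadic_floor :: "nat \<Rightarrow> real \<Rightarrow> real" where
  "dyadic_floor n x = dyadic_point n (nat \<lfloor>2 ^ n * x\<rfloor>)"

text \<open>Only differences to the endpoints of a dyadic interval are bounded; for two interior points the
  triangle inequality gives twice the bound.\<close>

definition endpoint_oscillation :: "(real \<Rightarrow> real) \<Rightarrow> (nat \<Rightarrow> real) \<Rightarrow> bool" where
  "endpoint_oscillation f B \<longleftrightarrow>
     (\<forall>n k x. k < 2 ^ n \<longrightarrow> x \<in> {dyadic_point n k..dyadic_point n (k + 1)} \<longrightarrow>
        \<bar>f x - f (dyadic_point n k)\<bar> \<le> B n \<and> \<bar>f x - f (dyadic_point n (k + 1))\<bar> \<le> B n)"

text \<open>What a single level \<open>n\<close> interval adds to the left sum when it is split at its midpoint.\<close>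

definition area_increment :: "(real \<Rightarrow> real) \<Rightarrow> (real \<Rightarrow> real) \<Rightarrow> nat \<Rightarrow> nat \<Rightarrow> real" where
  "area_increment f g n k =
     dyadic_increment f (Suc n) (2 * k) * dyadic_increment g (Suc n) (2 * k + 1)"

lemma endpoint_oscillation_nonneg:
  assumes "endpoint_oscillation f B"
  shows "0 \<le> B n"
proof -
  have "(0::nat) < 2 ^ n" "dyadic_point n 0 \<in> {dyadic_point n 0..dyadic_point n (0 + 1)}"
    by (simp_all add: dyadic_point_def)
  then have "\<bar>f (dyadic_point n 0) - f (dyadic_point n 0)\<bar> \<le> B n"
    using assms unfolding endpoint_oscillation_def by blast
  then show ?thesis by simp
qed

lemma real_nat_floor_mult:
  fixes x :: real
  assumes "0 \<le> x"
  shows "real (nat \<lfloor>2 ^ n * x\<rfloor>) = of_int \<lfloor>2 ^ n * x\<rfloor>"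
  using assms by (simp add: of_nat_nat)

lemma nat_floor_le_power:
  fixes x :: real
  assumes "x \<le> 1"
  shows "nat \<lfloor>2 ^ n * x\<rfloor> \<le> 2 ^ n"
proof -
  have "2 ^ n * x \<le> 2 ^ n * (1::real)"
    using assms by (intro mult_left_mono) auto
  then have "\<lfloor>2 ^ n * x\<rfloor> \<le> \<lfloor>2 ^ n :: real\<rfloor>"
    by (intro floor_mono) simp
  then have "\<lfloor>2 ^ n * x\<rfloor> \<le> 2 ^ n" by simp
  then show ?thesis by (simp add: nat_le_iff)
qed

lemma floor_bounds:
  fixes x :: real
  assumes "0 \<le> x"
  shows "dyadic_point n (nat \<lfloor>2 ^ n * x\<rfloor>) \<le> x"
    and "x < dyadic_point n (nat \<lfloor>2 ^ n * x\<rfloor> + 1)"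
proof -
  have "of_int \<lfloor>2 ^ n * x\<rfloor> \<le> 2 ^ n * x" "2 ^ n * x < of_int \<lfloor>2 ^ n * x\<rfloor> + 1"
    by linarith+
  then show "dyadic_point n (nat \<lfloor>2 ^ n * x\<rfloor>) \<le> x"
    and "x < dyadic_point n (nat \<lfloor>2 ^ n * x\<rfloor> + 1)"
    using real_nat_floor_mult[OF assms, of n]
    by (simp_all add: dyadic_point_def divide_le_eq less_divide_eq mult.commute add.commute)
qed

lemma nat_floor_Suc_cases:
  fixes x :: real
  assumes "0 \<le> x"
  shows "nat \<lfloor>2 ^ Suc n * x\<rfloor> = 2 * nat \<lfloor>2 ^ n * x\<rfloor> \<or>
    nat \<lfloor>2 ^ Suc n * x\<rfloor> = 2 * nat \<lfloor>2 ^ n * x\<rfloor> + 1"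
proof -
  have "\<lfloor>2 * (2 ^ n * x)\<rfloor> = 2 * \<lfloor>2 ^ n * x\<rfloor> \<or> \<lfloor>2 * (2 ^ n * x)\<rfloor> = 2 * \<lfloor>2 ^ n * x\<rfloor> + 1"
    by linarith
  moreover have "0 \<le> \<lfloor>2 ^ n * x\<rfloor>" using assms by simp
  ultimately show ?thesis
    by (auto simp: mult.assoc nat_add_distrib nat_mult_distrib)
qed

lemma endpoint_oscillation_floor:
  assumes "endpoint_oscillation f B" "0 \<le> y" "y \<le> 1"
    and x: "dyadic_floor n y \<le> x" "x \<le> y"
  shows "\<bar>f x - f (dyadic_floor n y)\<bar> \<le> B n"
proof (cases "nat \<lfloor>2 ^ n * y\<rfloor> < 2 ^ n")
  case True
  have "x \<in> {dyadic_point n (nat \<lfloor>2 ^ n * y\<rfloor>)..dyadic_point n (nat \<lfloor>2 ^ n * y\<rfloor> + 1)}"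
    using x floor_bounds(2)[OF assms(2), of n] by (simp add: dyadic_floor_def)
  then show ?thesis
    using assms(1) True unfolding endpoint_oscillation_def dyadic_floor_def by blast
next
  case False
  then have "dyadic_floor n y = 1"
    using nat_floor_le_power[OF assms(3), of n] by (simp add: dyadic_floor_def dyadic_point_def)
  then have "x = dyadic_floor n y"
    using x assms(3) by simp
  then show ?thesis
    using endpoint_oscillation_nonneg[OF assms(1)] by simp
qed

lemma dyadic_floor_le:
  assumes "0 \<le> x" shows "dyadic_floor n x \<le> x"
  using floor_bounds(1)[OF assms] by (simp add: dyadic_floor_def)

lemma dyadic_floor_mono_level:
  assumes "0 \<le> x" shows "dyadic_floor n x \<le> dyadic_floor (Suc n) x"
  using nat_floor_Suc_cases[OF assms, of n]
  by (auto simp: dyadic_floor_def dyadic_point_def divide_right_mono field_simps)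

lemma dyadic_floor_tendsto:
  assumes "0 \<le> x" shows "(\<lambda>n. dyadic_floor n x) \<longlonglongrightarrow> x"
proof (rule tendsto_sandwich)
  show "\<forall>\<^sub>F n in sequentially. x - (1 / 2) ^ n \<le> dyadic_floor n x"
  proof (intro always_eventually allI)
    fix n
    have "x < dyadic_floor n x + 1 / 2 ^ n"
      using floor_bounds(2)[OF assms, of n]
      by (simp add: dyadic_floor_def dyadic_point_def add_divide_distrib)
    then show "x - (1 / 2) ^ n \<le> dyadic_floor n x"
      by (simp add: power_divide)
  qed
  show "\<forall>\<^sub>F n in sequentially. dyadic_floor n x \<le> x"
    using dyadic_floor_le[OF assms] by simp
  have "(\<lambda>n. x - (1 / 2) ^ n) \<longlonglongrightarrow> x - 0"
    by (intro tendsto_diff tendsto_const LIMSEQ_power_zero) auto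
  then show "(\<lambda>n. x - (1 / 2) ^ n) \<longlonglongrightarrow> x" by simp
qed simp

lemma nat_floor_short_interval:
  fixes s t :: real
  assumes "0 \<le> s" "s \<le> t" "t - s \<le> 1 / 2 ^ N"
  shows "nat \<lfloor>2 ^ N * t\<rfloor> = nat \<lfloor>2 ^ N * s\<rfloor> \<or> nat \<lfloor>2 ^ N * t\<rfloor> = nat \<lfloor>2 ^ N * s\<rfloor> + 1"
proof -
  have "2 ^ N * s \<le> 2 ^ N * t" using assms by (intro mult_left_mono) auto
  moreover have "2 ^ N * t \<le> 2 ^ N * s + 1"
    using assms by (simp add: field_simps)
  moreover have "0 \<le> 2 ^ N * s" using assms by simp
  ultimately show ?thesis by linarith
qed

text \<open>A grid of mesh \<open>2\<^bsup>-N\<^esup>\<close> has at most one step between the roundings of \<open>s\<close> and \<open>t\<close>, so every point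
  of \<open>[s, t]\<close> lies in a dyadic interval that has the rounding of \<open>t\<close> as an endpoint.\<close>

lemma osc_at_upper_floor:
  assumes osc: "endpoint_oscillation h A"
    and "0 \<le> s" "s \<le> x" "x \<le> t" "t \<le> 1" "t - s \<le> 1 / 2 ^ N"
  shows "\<bar>h x - h (dyadic_floor N t)\<bar> \<le> A N"
proof (cases "dyadic_floor N t \<le> x")
  case True
  then show ?thesis
    using endpoint_oscillation_floor[OF osc, of t N x] assms by simp
next
  case False
  define K where "K = nat \<lfloor>2 ^ N * s\<rfloor>"
  have K: "dyadic_point N K \<le> s"
    using floor_bounds(1)[OF assms(2)] by (simp add: K_def)
  then have "nat \<lfloor>2 ^ N * t\<rfloor> \<noteq> K"
    using False assms by (auto simp: dyadic_floor_def)
  then have fl: "nat \<lfloor>2 ^ N * t\<rfloor> = K + 1"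
    using nat_floor_short_interval[of s t N] assms by (auto simp: K_def)
  then have "K < 2 ^ N" using nat_floor_le_power[OF assms(5), of N] by simp
  moreover have "x \<in> {dyadic_point N K..dyadic_point N (K + 1)}"
    using K False assms fl by (simp add: dyadic_floor_def)
  ultimately show ?thesis
    using osc fl unfolding endpoint_oscillation_def dyadic_floor_def by auto
qed

section \<open>Left sums of a pair with summable oscillation products\<close>

text \<open>Besides splitting the intervals that are already counted, refinement may add one more interval
  of half the length at the right end; its contribution is the last summand.\<close>

lemma left_sum_Suc:
  assumes "0 \<le> x"
  shows "left_sum f g (Suc n) x = left_sum f g n x
    + (\<Sum>k<nat \<lfloor>2 ^ n * x\<rfloor>. area_increment f g n k)
    + f (dyadic_floor n x) * (g (dyadic_floor (Suc n) x) - g (dyadic_floor n x))"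
proof -
  define K where "K = nat \<lfloor>2 ^ n * x\<rfloor>"
  define F where "F j = f (dyadic_point (Suc n) j) * (g (dyadic_point (Suc n) (j + 1)) - g (dyadic_point (Suc n) j))" for j
  have double: "(\<Sum>j<2 * K. F j) = left_sum f g n x + (\<Sum>k<K. area_increment f g n k)"
    unfolding sum_double_lessThan left_sum_def K_def[symmetric] sum.distrib[symmetric]
    by (intro sum.cong)
      (simp_all add: F_def area_increment_def dyadic_increment_def
        left_diff_distrib right_diff_distrib)
  have ls: "left_sum f g (Suc n) x = (\<Sum>j<nat \<lfloor>2 ^ Suc n * x\<rfloor>. F j)"
    by (simp add: left_sum_def F_def)
  have fl: "dyadic_floor n x = dyadic_point (Suc n) (2 * K)"
    by (simp add: dyadic_floor_def K_def)
  have last: "F (2 * K) = f (dyadic_floor n x) *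
      (g (dyadic_point (Suc n) (Suc (2 * K))) - g (dyadic_floor n x))"
    by (simp add: F_def fl)
  from nat_floor_Suc_cases[OF assms, of n] show ?thesis
  proof
    assume "nat \<lfloor>2 ^ Suc n * x\<rfloor> = 2 * nat \<lfloor>2 ^ n * x\<rfloor>"
    then have "nat \<lfloor>2 ^ Suc n * x\<rfloor> = 2 * K" by (simp add: K_def)
    then show ?thesis
      unfolding ls dyadic_floor_def[of "Suc n"] by (simp add: double fl flip: K_def)
  next
    assume "nat \<lfloor>2 ^ Suc n * x\<rfloor> = 2 * nat \<lfloor>2 ^ n * x\<rfloor> + 1"
    then have "nat \<lfloor>2 ^ Suc n * x\<rfloor> = Suc (2 * K)" by (simp add: K_def)
    then show ?thesis
      unfolding ls dyadic_floor_def[of "Suc n"] by (simp add: double last flip: K_def)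
  qed
qed

text \<open>The correction \<open>f x * g (dyadic_floor n x)\<close> makes the last summand of \<open>left_sum_Suc\<close> a product of two
  small differences.\<close>

definition pinned_sum :: "(real \<Rightarrow> real) \<Rightarrow> (real \<Rightarrow> real) \<Rightarrow> nat \<Rightarrow> real \<Rightarrow> real" where
  "pinned_sum f g n x = left_sum f g n x - f x * g (dyadic_floor n x)"

definition pinned_step :: "(real \<Rightarrow> real) \<Rightarrow> (real \<Rightarrow> real) \<Rightarrow> nat \<Rightarrow> real \<Rightarrow> real" where
  "pinned_step f g n x =
     (f (dyadic_floor n x) - f x) * (g (dyadic_floor (Suc n) x) - g (dyadic_floor n x))"

lemma pinned_sum_Suc:
  assumes "0 \<le> x"
  shows "pinned_sum f g (Suc n) x - pinned_sum f g n x
    = (\<Sum>k<nat \<lfloor>2 ^ n * x\<rfloor>. area_increment f g n k) + pinned_step f g n x"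
  using left_sum_Suc[OF assms, of f g n] by (simp add: pinned_sum_def pinned_step_def algebra_simps)

text \<open>What the convergence argument uses of \<open>f\<close> and \<open>g\<close>: they are continuous, the oscillations on level \<open>n\<close> are bounded
  by \<open>B n\<close> and \<open>C n\<close>, the terms that a refinement adds by their product, and the products are summable.\<close>

locale controlled_pair =
  fixes f g :: "real \<Rightarrow> real" and B C :: "nat \<Rightarrow> real"
  assumes cont_f: "continuous_on {0..1} f" and cont_g: "continuous_on {0..1} g"
    and osc_f: "endpoint_oscillation f B" and osc_g: "endpoint_oscillation g C"
    and area: "\<And>n K L. L \<le> 2 ^ n \<Longrightarrow> \<bar>\<Sum>k\<in>{K..<L}. area_increment f g n k\<bar> \<le> B n * C n"
    and summable_BC: "summable (\<lambda>n. B n * C n)"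
begin

lemma B_nonneg [simp]: "0 \<le> B n" and C_nonneg [simp]: "0 \<le> C n"
  using endpoint_oscillation_nonneg osc_f osc_g by auto

lemma pinned_step_le:
  assumes "0 \<le> x" "x \<le> 1"
  shows "\<bar>pinned_step f g n x\<bar> \<le> B n * C n"
proof -
  have "\<bar>f (dyadic_floor n x) - f x\<bar> \<le> B n"
    using endpoint_oscillation_floor[OF osc_f assms, of n x] dyadic_floor_le[OF assms(1)]
    by (simp add: abs_minus_commute)
  moreover have "\<bar>g (dyadic_floor (Suc n) x) - g (dyadic_floor n x)\<bar> \<le> C n"
    using endpoint_oscillation_floor[OF osc_g assms, of n "dyadic_floor (Suc n) x"]
      dyadic_floor_mono_level[OF assms(1)] dyadic_floor_le[OF assms(1)]
    by simp
  ultimately show ?thesis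
    unfolding pinned_step_def abs_mult by (intro mult_mono) auto
qed

definition tail :: "nat \<Rightarrow> real" where
  "tail N = (\<Sum>n. B (n + N) * C (n + N))"

lemma summable_shift: "summable (\<lambda>n. B (n + N) * C (n + N))"
  using summable_ignore_initial_segment[OF summable_BC, of N] by simp

lemma first_le_tail: "B N * C N \<le> tail N"
  using sum_le_suminf[OF summable_shift[of N], of "{0}"] by (simp add: tail_def)

lemma tail_tendsto_0: "tail \<longlonglongrightarrow> 0"
  using suminf_exist_split2[OF summable_BC] by (simp add: tail_def[abs_def])

definition pinned_limit :: "real \<Rightarrow> real" where
  "pinned_limit x = lim (\<lambda>n. pinned_sum f g n x)"

lemma pinned_limit:
  assumes x: "0 \<le> x" "x \<le> 1"
  shows "(\<lambda>n. pinned_sum f g n x) \<longlonglongrightarrow> pinned_limit x"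
proof -
  have "\<bar>pinned_sum f g (Suc n) x - pinned_sum f g n x\<bar> \<le> 2 * (B n * C n)" for n
    unfolding pinned_sum_Suc[OF x(1)]
    using area[OF nat_floor_le_power[OF x(2)], of n 0] pinned_step_le[OF x, of n]
    by (simp add: lessThan_atLeast0)
  then have "summable (\<lambda>n. pinned_sum f g (Suc n) x - pinned_sum f g n x)"
    by (intro summable_comparison_test'[OF summable_mult[OF summable_BC, of 2], where N = 0]) simp
  then have "convergent (\<lambda>n. pinned_sum f g 0 x + (\<Sum>i<n. pinned_sum f g (Suc i) x - pinned_sum f g i x))"
    unfolding summable_iff_convergent by (rule convergent_add[OF convergent_const])
  then show ?thesis
    unfolding sum_lessThan_telescope[of "\<lambda>n. pinned_sum f g n x"] pinned_limit_def
      convergent_LIMSEQ_iff by simp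
qed

text \<open>Undoing the correction in the limit: \<open>g (dyadic_floor n x)\<close> tends to \<open>g x\<close> by continuity.\<close>

definition FS_primitive :: "real \<Rightarrow> real" where
  "FS_primitive x = pinned_limit x + f x * g x"

lemma left_sum_tendsto:
  assumes x: "0 \<le> x" "x \<le> 1"
  shows "(\<lambda>n. left_sum f g n x) \<longlonglongrightarrow> FS_primitive x"
proof -
  have "0 \<le> dyadic_floor n x" for n
    by (simp add: dyadic_floor_def dyadic_point_def)
  then have "dyadic_floor n x \<in> {0..1}" for n
    using dyadic_floor_le[OF x(1), of n] x(2) by simp
  then have "(\<lambda>n. g (dyadic_floor n x)) \<longlonglongrightarrow> g x"
    using x by (intro continuous_on_tendsto_compose[OF cont_g] dyadic_floor_tendsto) auto
  then have "(\<lambda>n. pinned_sum f g n x + f x * g (dyadic_floor n x)) \<longlonglongrightarrow> FS_primitive x"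
    unfolding FS_primitive_def by (intro tendsto_intros pinned_limit x)
  then show ?thesis by (simp add: pinned_sum_def)
qed

text \<open>Each level contributes the newly added area between the roundings of \<open>s\<close> and \<open>t\<close> and one boundary term at each
  of the two ends, hence the factor \<open>3\<close>.\<close>

lemma pinned_limit_diff_le:
  assumes "0 \<le> s" "s \<le> t" "t \<le> 1"
  shows "\<bar>(pinned_limit t - pinned_limit s) - (pinned_sum f g N t - pinned_sum f g N s)\<bar> \<le> 3 * tail N"
proof -
  define D where "D n = pinned_sum f g n t - pinned_sum f g n s" for n
  have step: "\<bar>D (Suc n) - D n\<bar> \<le> 3 * (B n * C n)" for n
  proof -
    have le: "nat \<lfloor>2 ^ n * s\<rfloor> \<le> nat \<lfloor>2 ^ n * t\<rfloor>"
      using assms by (intro nat_mono floor_mono mult_left_mono) auto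
    have "D (Suc n) - D n = (\<Sum>k\<in>{nat \<lfloor>2 ^ n * s\<rfloor>..<nat \<lfloor>2 ^ n * t\<rfloor>}. area_increment f g n k)
        + pinned_step f g n t - pinned_step f g n s"
      using pinned_sum_Suc[of t f g n] pinned_sum_Suc[of s f g n] assms
        sum_diff_nat_ivl[of 0 "nat \<lfloor>2 ^ n * s\<rfloor>" "nat \<lfloor>2 ^ n * t\<rfloor>" "area_increment f g n"] le
      by (simp add: D_def lessThan_atLeast0)
    then show ?thesis
      using area[OF nat_floor_le_power[of t], of n "nat \<lfloor>2 ^ n * s\<rfloor>"] assms
        pinned_step_le[of t n] pinned_step_le[of s n] by linarith
  qed
  have "D \<longlonglongrightarrow> pinned_limit t - pinned_limit s"
    unfolding D_def[abs_def] using assms by (intro tendsto_diff pinned_limit) auto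
  then have "(\<lambda>n. D (n + N)) \<longlonglongrightarrow> pinned_limit t - pinned_limit s"
    by (rule LIMSEQ_ignore_initial_segment)
  then have sums: "(\<lambda>n. D (Suc n + N) - D (n + N)) sums ((pinned_limit t - pinned_limit s) - D N)"
    using telescope_sums[of "\<lambda>n. D (n + N)"] by simp
  have "\<bar>\<Sum>n. D (Suc n + N) - D (n + N)\<bar> \<le> (\<Sum>n. 3 * (B (n + N) * C (n + N)))"
  proof -
    have bd: "norm (D (Suc n + N) - D (n + N)) \<le> 3 * (B (n + N) * C (n + N))" for n
      using step[of "n + N"] by simp
    show ?thesis
      using norm_suminf_le[OF bd summable_mult[OF summable_shift]] by simp
  qed
  then show ?thesis
    using sums_unique[OF sums] by (simp add: tail_def D_def suminf_mult[OF summable_shift])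
qed

text \<open>The levels from \<open>N\<close> on cost \<open>3 * tail N\<close>. On level \<open>N\<close> the left sums up to \<open>s\<close> and \<open>t\<close> differ by
  at most one term, and the discrepancy is a sum of three products that cost \<open>2 + 1 + 2\<close> times the
  first term of the tail: a difference of \<open>f\<close> to \<open>f \<xi>\<close> is taken through the rounding of \<open>t\<close> and counts
  twice.\<close>

lemma primitive_estimate:
  assumes st: "0 \<le> s" "s \<le> \<xi>" "\<xi> \<le> t" "t \<le> 1" "t - s \<le> 1 / 2 ^ N"
  shows "\<bar>FS_primitive t - FS_primitive s - f \<xi> * (g t - g s)\<bar> \<le> 8 * tail N"
proof -
  define u v where "u = dyadic_floor N s" and "v = dyadic_floor N t"
  have s_le_t: "s \<le> t" using st by simp
  have left: "left_sum f g N t - left_sum f g N s = f u * (g v - g u)"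
    using nat_floor_short_interval[OF st(1) s_le_t st(5)]
    by (auto simp: left_sum_def u_def v_def dyadic_floor_def)
  \<comment> \<open>valid both for \<open>u = v\<close> and when \<open>v\<close> is the grid point next to \<open>u\<close>\<close>
  have split: "pinned_sum f g N t - pinned_sum f g N s + f t * g t - f s * g s - f \<xi> * (g t - g s)
      = (f t - f \<xi>) * (g t - g v) + (f u - f s) * (g v - g u) + (f s - f \<xi>) * (g v - g s)"
    using left by (simp add: pinned_sum_def u_def v_def algebra_simps)
  have f_v: "\<bar>f x - f v\<bar> \<le> B N" and g_v: "\<bar>g x - g v\<bar> \<le> C N" if "s \<le> x" "x \<le> t" for x
    using osc_at_upper_floor[OF osc_f st(1) that st(4,5)]
      osc_at_upper_floor[OF osc_g st(1) that st(4,5)] by (simp_all add: v_def)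
  have f_u: "\<bar>f u - f s\<bar> \<le> B N"
    using endpoint_oscillation_floor[OF osc_f st(1), of N s] dyadic_floor_le[OF st(1)] st
    by (simp add: u_def abs_minus_commute)
  have g_uv: "\<bar>g v - g u\<bar> \<le> C N"
  proof -
    consider "v = u" | "v = dyadic_point N (nat \<lfloor>2 ^ N * s\<rfloor> + 1)" "nat \<lfloor>2 ^ N * s\<rfloor> < 2 ^ N"
      using nat_floor_short_interval[OF st(1) s_le_t st(5)] nat_floor_le_power[OF st(4), of N]
      by (auto simp: u_def v_def dyadic_floor_def)
    then show ?thesis
    proof cases
      case 2
      have "v \<in> {dyadic_point N (nat \<lfloor>2 ^ N * s\<rfloor>)..dyadic_point N (nat \<lfloor>2 ^ N * s\<rfloor> + 1)}"
        unfolding 2(1) by (simp add: dyadic_point_def divide_right_mono)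
      then show ?thesis
        using osc_g 2(2) unfolding endpoint_oscillation_def u_def dyadic_floor_def by blast
    qed simp
  qed
  have "\<bar>f t - f \<xi>\<bar> \<le> 2 * B N" "\<bar>f s - f \<xi>\<bar> \<le> 2 * B N"
    using f_v[of t] f_v[of s] f_v[of \<xi>] st by linarith+
  moreover have "\<bar>g t - g v\<bar> \<le> C N" "\<bar>g v - g s\<bar> \<le> C N"
    using g_v[of t] g_v[of s] st by linarith+
  ultimately have "\<bar>(f t - f \<xi>) * (g t - g v)\<bar> \<le> 2 * B N * C N"
    "\<bar>(f u - f s) * (g v - g u)\<bar> \<le> B N * C N"
    "\<bar>(f s - f \<xi>) * (g v - g s)\<bar> \<le> 2 * B N * C N"
    unfolding abs_mult using f_u g_uv by (intro mult_mono; simp)+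
  then have "\<bar>pinned_sum f g N t - pinned_sum f g N s + f t * g t - f s * g s - f \<xi> * (g t - g s)\<bar>
      \<le> 5 * (B N * C N)"
    unfolding split by linarith
  then show ?thesis
    using pinned_limit_diff_le[OF st(1) s_le_t st(4), of N] first_le_tail[of N]
    unfolding FS_primitive_def by linarith
qed

text \<open>Continuity at \<open>x\<close> is the preceding estimate for the interval between \<open>x\<close> and \<open>y\<close>, with \<open>x\<close> as the
  intermediate point, because the tail vanishes as the level grows.\<close>

lemma continuous_primitive: "continuous_on {0..1} FS_primitive"
proof (rule continuous_onI)
  fix x e :: real
  assume x: "x \<in> {0..1}" and e: "0 < e"
  define M where "M = \<bar>f x\<bar> + 1"
  have "0 < M" by (simp add: M_def)
  obtain N where N: "8 * tail N < e / 2"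
  proof -
    have "(\<lambda>N. 8 * tail N) \<longlonglongrightarrow> 8 * 0"
      by (intro tendsto_intros tail_tendsto_0)
    then have "\<forall>\<^sub>F N in sequentially. 8 * tail N < e / 2"
      using e by (intro order_tendstoD(2)[where y = "8 * 0"]) auto
    then show ?thesis
      using that by (auto simp: eventually_sequentially)
  qed
  \<comment> \<open>\<open>f x\<close> may vanish, so its modulus is enlarged by \<open>1\<close> before dividing\<close>
  obtain d where d: "0 < d" "\<And>y. y \<in> {0..1} \<Longrightarrow> dist y x < d \<Longrightarrow> dist (g y) (g x) < e / (2 * M)"
    using cont_g x e \<open>0 < M\<close> unfolding continuous_on_iff
    by (metis divide_pos_pos mult_pos_pos zero_less_numeral)
  show "\<exists>d>0. \<forall>y\<in>{0..1}. dist y x < d \<longrightarrow> dist (FS_primitive y) (FS_primitive x) \<le> e"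
  proof (intro exI conjI ballI impI)
    show "0 < min d (1 / 2 ^ N)" using d by simp
    fix y :: real
    assume y: "y \<in> {0..1}" "dist y x < min d (1 / 2 ^ N)"
    have "\<bar>FS_primitive y - FS_primitive x - f x * (g y - g x)\<bar> \<le> 8 * tail N"
    proof (cases "x \<le> y")
      case True
      then show ?thesis
        using primitive_estimate[of x x y N] x y by (simp add: dist_real_def)
    next
      case False
      then have "\<bar>FS_primitive x - FS_primitive y - f x * (g x - g y)\<bar> \<le> 8 * tail N"
        using primitive_estimate[of y x x N] x y by (simp add: dist_real_def)
      then show ?thesis by (simp add: algebra_simps abs_if split: if_splits)
    qed
    moreover have "\<bar>f x * (g y - g x)\<bar> \<le> e / 2"
    proof -
      have "\<bar>f x\<bar> * \<bar>g y - g x\<bar> \<le> M * (e / (2 * M))"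
        using d(2)[of y] y by (intro mult_mono) (auto simp: M_def dist_real_def)
      then show ?thesis
        using \<open>0 < M\<close> by (simp add: abs_mult)
    qed
    ultimately show "dist (FS_primitive y) (FS_primitive x) \<le> e"
      using N by (simp add: dist_real_def)
  qed
qed

lemma is_FS_integral_primitive: "is_FS_integral f g FS_primitive"
proof -
  have lim: "(\<lambda>j. left_sum f g (level t + j) t) \<longlonglongrightarrow> FS_primitive t" if "t \<in> dyadic_points" for t
  proof -
    have "0 \<le> t" "t \<le> 1" using that dyadic_points_subset by auto
    then show ?thesis
      using LIMSEQ_ignore_initial_segment[OF left_sum_tendsto, of t "level t"]
      by (simp add: add.commute)
  qed
  then show ?thesis
    unfolding is_FS_integral_def dyadic_integrable_def dyadic_integral_def
    using continuous_primitive by (auto simp: convergent_def limI[THEN sym])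
qed

lemma FS_integral_eq_primitive:
  assumes "x \<in> {0..1}"
  shows "FS_integral f g x = FS_primitive x"
proof -
  have "is_FS_integral f g (FS_integral f g)"
    unfolding FS_integral_def
    by (rule someI[of "is_FS_integral f g", OF is_FS_integral_primitive])
  then show ?thesis
    using is_FS_integral_unique is_FS_integral_primitive assms by blast
qed

end

section \<open>Sequence norms and geometric averages\<close>

lemma sum_le_infsum_ennreal:
  fixes a :: "'i \<Rightarrow> ennreal"
  assumes "finite F" "F \<subseteq> A"
  shows "sum a F \<le> infsum a A"
  unfolding nonneg_infsum_complete[OF zero_le] using assms by (intro SUP_upper) auto

lemma ennreal_finite_lp_norm_le:
  assumes p: "1 < p" and F: "finite F" "F \<subseteq> A"
  shows "ennreal (finite_lp_norm p F a) \<le> lp_norm A p (\<lambda>i. ennreal \<bar>a i\<bar>)"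
proof -
  define X where "X = (\<Sum>\<^sub>\<infinity>i\<in>A. ennreal_powr (ennreal \<bar>a i\<bar>) p)"
  have "ennreal (\<Sum>i\<in>F. \<bar>a i\<bar> powr p) = (\<Sum>i\<in>F. ennreal_powr (ennreal \<bar>a i\<bar>) p)"
    by (simp add: ennreal_powr_def flip: sum_ennreal)
  also have "\<dots> \<le> X"
    unfolding X_def by (intro sum_le_infsum_ennreal F)
  finally have le: "ennreal (\<Sum>i\<in>F. \<bar>a i\<bar> powr p) \<le> X" .
  have norm_eq: "lp_norm A p (\<lambda>i. ennreal \<bar>a i\<bar>) = ennreal_powr X (1 / p)"
    by (simp only: lp_norm_def X_def)
  show ?thesis
  proof (cases "X = \<infinity>")
    case True
    then show ?thesis by (simp add: norm_eq ennreal_powr_def)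
  next
    case False
    then have "(\<Sum>i\<in>F. \<bar>a i\<bar> powr p) \<le> enn2real X"
      using enn2real_mono[OF le] by (simp add: less_top sum_nonneg)
    then have "finite_lp_norm p F a \<le> enn2real X powr (1 / p)"
      unfolding finite_lp_norm_def using p by (intro powr_mono2 sum_nonneg) auto
    then show ?thesis
      using False by (simp add: norm_eq ennreal_powr_def ennreal_leI)
  qed
qed

lemma in_lp_finite:
  assumes "1 < p" "in_lp A p a" "i \<in> A"
  shows "a i < \<infinity>"
proof (rule ccontr)
  assume "\<not> a i < \<infinity>"
  then have "a i = \<infinity>" by (metis infinity_ennreal_def top.not_eq_extremum)
  then have "(\<Sum>j\<in>{i}. ennreal_powr (a j) p) = \<infinity>"
    by (simp add: ennreal_powr_def)
  moreover have "(\<Sum>j\<in>{i}. ennreal_powr (a j) p) \<le> (\<Sum>\<^sub>\<infinity>j\<in>A. ennreal_powr (a j) p)"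
    using assms by (intro sum_le_infsum_ennreal) auto
  ultimately have "(\<Sum>\<^sub>\<infinity>j\<in>A. ennreal_powr (a j) p) = \<infinity>"
    by (simp add: top_unique)
  then show False
    using assms(2) by (simp add: in_lp_def lp_norm_def ennreal_powr_def)
qed

lemma in_lp_sum_bounded:
  assumes p: "1 < p" and a: "in_lp A p (\<lambda>i. ennreal \<bar>a i\<bar>)" and F: "finite F" "F \<subseteq> A"
  shows "(\<Sum>i\<in>F. \<bar>a i\<bar> powr p) \<le> enn2real (lp_norm A p (\<lambda>i. ennreal \<bar>a i\<bar>)) powr p"
proof -
  have "finite_lp_norm p F a \<le> enn2real (lp_norm A p (\<lambda>i. ennreal \<bar>a i\<bar>))"
    using enn2real_mono[OF ennreal_finite_lp_norm_le[OF p F, of a]] a by (simp add: in_lp_def)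
  then have "finite_lp_norm p F a powr p \<le> enn2real (lp_norm A p (\<lambda>i. ennreal \<bar>a i\<bar>)) powr p"
    using p by (intro powr_mono2) auto
  then show ?thesis by (simp add: finite_lp_norm_powr[OF p])
qed

text \<open>The injection \<open>e\<close> picks the indices to keep: the energies are indexed by integers from \<open>-1\<close> on,
  the averages by naturals.\<close>

lemma in_lp_imp_summable:
  fixes e :: "nat \<Rightarrow> 'i"
  assumes p: "1 < p" and a: "in_lp A p (\<lambda>i. ennreal \<bar>a i\<bar>)" and e: "inj e" "range e \<subseteq> A"
  shows "summable (\<lambda>n. \<bar>a (e n)\<bar> powr p)"
proof (rule summableI_nonneg_bounded)
  fix n
  have "(\<Sum>k<n. \<bar>a (e k)\<bar> powr p) = (\<Sum>i\<in>e ` {..<n}. \<bar>a i\<bar> powr p)"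
    using e(1) by (subst sum.reindex) (auto intro: inj_on_subset)
  also have "\<dots> \<le> enn2real (lp_norm A p (\<lambda>i. ennreal \<bar>a i\<bar>)) powr p"
    using e(2) by (intro in_lp_sum_bounded p a) auto
  finally show "(\<Sum>k<n. \<bar>a (e k)\<bar> powr p) \<le> enn2real (lp_norm A p (\<lambda>i. ennreal \<bar>a i\<bar>)) powr p" .
qed simp

text \<open>A special case of Young's convolution inequality. Convexity with weights \<open>r\<close> and \<open>1 - r\<close> gives
  \<open>a\<^sub>n\<^sub>+\<^sub>1\<^sup>p \<le> r a\<^sub>n\<^sup>p + c z\<^sub>n\<^sub>+\<^sub>1\<^sup>p\<close>; summing over \<open>n\<close>, the term with \<open>r < 1\<close> is absorbed on the left.\<close>

lemma summable_powr_geometric_average: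
  fixes a z :: "nat \<Rightarrow> real"
  assumes p: "1 < p" and r: "0 \<le> r" "r < 1"
    and nonneg: "\<And>n. 0 \<le> a n" "\<And>n. 0 \<le> z n"
    and rec: "\<And>n. a (Suc n) = r * a n + z (Suc n)"
    and z: "summable (\<lambda>n. z n powr p)"
  shows "summable (\<lambda>n. a n powr p)"
proof -
  define c where "c = (1 - r) * (1 / (1 - r)) powr p"
  define K where "K = a 0 powr p + c * (\<Sum>n. z n powr p)"
  have c: "0 \<le> c" using r by (simp add: c_def)
  have step: "a (Suc n) powr p \<le> r * a n powr p + c * z (Suc n) powr p" for n
  proof -
    \<comment> \<open>the new term is divided by its weight \<open>1 - r\<close> to make this a convex combination\<close>
    have "a (Suc n) = r * a n + (1 - r) * (1 / (1 - r) * z (Suc n))"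
      using r rec by simp
    also have "\<dots> powr p \<le> r * a n powr p + (1 - r) * (1 / (1 - r) * z (Suc n)) powr p"
      using r nonneg by (intro powr_two_point_convex p) auto
    also have "(1 / (1 - r) * z (Suc n)) powr p = (1 / (1 - r)) powr p * z (Suc n) powr p"
      using r nonneg by (intro powr_mult)
    finally show ?thesis by (simp add: c_def mult.assoc)
  qed
  have "(\<Sum>n<N. a n powr p) \<le> K / (1 - r)" for N
  proof -
    have "(\<Sum>n<Suc N. a n powr p) = a 0 powr p + (\<Sum>n<N. a (Suc n) powr p)"
      by (rule sum.lessThan_Suc_shift)
    also have "\<dots> \<le> a 0 powr p + (\<Sum>n<N. r * a n powr p + c * z (Suc n) powr p)"
      by (intro add_left_mono sum_mono step)
    also have "\<dots> = a 0 powr p + r * (\<Sum>n<N. a n powr p) + c * (\<Sum>n<N. z (Suc n) powr p)"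
      by (simp add: sum.distrib sum_distrib_left)
    also have "(\<Sum>n<N. z (Suc n) powr p) \<le> (\<Sum>n<Suc N. z n powr p)"
      unfolding sum.lessThan_Suc_shift[of _ N] by simp
    also have "(\<Sum>n<Suc N. z n powr p) \<le> (\<Sum>n. z n powr p)"
      by (intro sum_le_suminf z) auto
    finally have "(\<Sum>n<Suc N. a n powr p) \<le> K + r * (\<Sum>n<N. a n powr p)"
      using c by (simp add: K_def mult_left_mono)
    moreover have "(\<Sum>n<N. a n powr p) \<le> (\<Sum>n<Suc N. a n powr p)" by simp
    ultimately have "(\<Sum>n<N. a n powr p) - r * (\<Sum>n<N. a n powr p) \<le> K"
      by linarith
    then have "(1 - r) * (\<Sum>n<N. a n powr p) \<le> K"
      by (simp add: left_diff_distrib)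
    then show ?thesis
      using r by (simp add: pos_le_divide_eq mult.commute)
  qed
  then show ?thesis
    by (intro summableI_nonneg_bounded) auto
qed

lemma energy_average_summable:
  assumes p: "1 < p" and lp: "in_lp {-1..} p (\<lambda>n. ennreal \<bar>level_energy p f n\<bar>)"
  shows "summable (\<lambda>n. energy_average p f n powr p)"
proof (rule summable_powr_geometric_average[OF p, where r = "2 powr (1 / p - 1)"
      and z = "\<lambda>n. level_energy p f (int n)"])
  show "2 powr (1 / p - 1) < (1::real)"
    using p by (simp add: powr_less_one)
  show "summable (\<lambda>n. level_energy p f (int n) powr p)"
    using in_lp_imp_summable[OF p lp, of int] by (simp add: image_subset_iff)
  show "energy_average p f (Suc n)
      = 2 powr (1 / p - 1) * energy_average p f n + level_energy p f (int (Suc n))" for n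
    by (rule energy_average_Suc)
qed simp_all

section \<open>Oscillation over dyadic intervals\<close>

text \<open>Stated with the same expression as in the Schauder tail, so that its sums are
  partial sums of that series; it majorises the second differences of level \<open>m\<close>.\<close>

definition level_height :: "(real \<Rightarrow> real) \<Rightarrow> nat \<Rightarrow> real" where
  "level_height f m = 2 powr (- (real m / 2)) * (SUP k\<in>{..<2 ^ m}. \<bar>schauder_coeff f (int m) k\<bar>)"

lemma second_difference_le_level_height:
  assumes "k < 2 ^ m"
  shows "\<bar>second_difference f m k\<bar> \<le> level_height f m"
proof -
  have "\<bar>second_difference f m k\<bar> = 2 powr (- (real m / 2)) * \<bar>schauder_coeff f (int m) k\<bar>"
    by (simp add: schauder_coeff_eq abs_mult flip: mult.assoc powr_add)
  also have "\<dots> \<le> level_height f m"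
    unfolding level_height_def using assms by (intro mult_left_mono cSUP_upper) auto
  finally show ?thesis .
qed

lemma level_height_nonneg: "0 \<le> level_height f m"
  using second_difference_le_level_height[of 0 m f] abs_ge_zero order_trans by fastforce

lemma level_height_sum_le_tail:
  assumes "schauder_tail f n < \<infinity>"
  shows "(\<Sum>m\<in>{n..<M}. level_height f m) \<le> enn2real (schauder_tail f n)"
proof -
  have "ennreal (\<Sum>m\<in>{n..<M}. level_height f m) = (\<Sum>m\<in>{n..<M}. ennreal (level_height f m))"
    by (simp add: level_height_nonneg)
  also have "\<dots> \<le> schauder_tail f n"
    unfolding schauder_tail_def level_height_def by (intro sum_le_infsum_ennreal) auto
  finally show ?thesis
    using assms enn2real_mono[of "ennreal (\<Sum>m\<in>{n..<M}. level_height f m)" "schauder_tail f n"]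
    by (simp add: sum_nonneg level_height_nonneg)
qed

text \<open>Downward induction on the level. On level \<open>M\<close> the function varies by at most \<open>e\<close> over an interval. Going
  from level \<open>n + 1\<close> to \<open>n\<close>, the secant over a half of the interval differs from the secant over the whole by a
  multiple of the second difference, with a tent-shaped factor of at most \<open>1/2\<close>.\<close>

lemma interpolation_error:
  fixes f :: "real \<Rightarrow> real"
  assumes "n \<le> M"
    and close: "\<And>y z. y \<in> {0..1} \<Longrightarrow> z \<in> {0..1} \<Longrightarrow> \<bar>y - z\<bar> \<le> 1 / 2 ^ M \<Longrightarrow> \<bar>f y - f z\<bar> \<le> e"
    and x: "k < 2 ^ n" "real k \<le> 2 ^ n * x" "2 ^ n * x \<le> real k + 1"
  shows "\<bar>f x - ((1 - (2 ^ n * x - real k)) * f (dyadic_point n k)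
      + (2 ^ n * x - real k) * f (dyadic_point n (k + 1)))\<bar>
    \<le> (\<Sum>m\<in>{n..<M}. level_height f m) / 2 + e"
  using assms(1) x
proof (induction n arbitrary: k rule: inc_induct)
  case base
  define w where "w = 2 ^ M * x - real k"
  have w: "0 \<le> w" "w \<le> 1" using base by (auto simp: w_def)
  have "real k + 1 \<le> 2 ^ M"
    using base(1) by (metis Suc_leI of_nat_Suc of_nat_le_iff of_nat_numeral of_nat_power add.commute)
  then have in01: "dyadic_point M k \<in> {0..1}" "dyadic_point M (k + 1) \<in> {0..1}"
    using base(1) by (auto simp: dyadic_point_def)
  have ord: "dyadic_point M k \<le> x" "x \<le> dyadic_point M (k + 1)"
    using base by (auto simp: dyadic_point_def field_simps)
  have len: "dyadic_point M (k + 1) - dyadic_point M k = 1 / 2 ^ M"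
    by (simp add: dyadic_point_def add_divide_distrib)
  have "x \<in> {0..1}" using in01 ord by simp
  then have "\<bar>f x - f (dyadic_point M k)\<bar> \<le> e" "\<bar>f x - f (dyadic_point M (k + 1))\<bar> \<le> e"
    using close[of x "dyadic_point M k"] close[of x "dyadic_point M (k + 1)"] in01 ord len
    by linarith+
  then have "(1 - w) * \<bar>f x - f (dyadic_point M k)\<bar> + w * \<bar>f x - f (dyadic_point M (k + 1))\<bar>
      \<le> (1 - w) * e + w * e"
    using w by (intro add_mono mult_left_mono) auto
  moreover have "\<bar>(1 - w) * (f x - f (dyadic_point M k)) + w * (f x - f (dyadic_point M (k + 1)))\<bar>
      \<le> (1 - w) * \<bar>f x - f (dyadic_point M k)\<bar> + w * \<bar>f x - f (dyadic_point M (k + 1))\<bar>"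
    using w by (simp add: abs_mult order_trans[OF abs_triangle_ineq])
  moreover have "f x - ((1 - w) * f (dyadic_point M k) + w * f (dyadic_point M (k + 1)))
      = (1 - w) * (f x - f (dyadic_point M k)) + w * (f x - f (dyadic_point M (k + 1)))"
    by (simp add: algebra_simps)
  ultimately show ?case
    unfolding w_def[symmetric] by (simp add: algebra_simps)
next
  case (step n)
  define w where "w = 2 ^ n * x - real k"
  define a b c where "a = f (dyadic_point n k)" and "b = f (dyadic_point n (k + 1))"
    and "c = f (dyadic_point (Suc n) (2 * k + 1))"
  have w: "0 \<le> w" "w \<le> 1" using step.prems by (auto simp: w_def)
  have half: "\<bar>2 * c - a - b\<bar> \<le> level_height f n"
    using second_difference_le_level_height[OF step.prems(1), of f]
    by (simp add: second_difference_def a_def b_def c_def)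
  have sum_eq: "(\<Sum>m\<in>{n..<M}. level_height f m)
      = level_height f n + (\<Sum>m\<in>{Suc n..<M}. level_height f m)"
    using step.hyps by (simp add: sum.atLeast_Suc_lessThan)
  have close_half: "\<bar>f x - ((1 - w) * a + w * b)\<bar>
      \<le> (\<Sum>m\<in>{n..<M}. level_height f m) / 2 + e"
    if "\<bar>f x - y\<bar> \<le> (\<Sum>m\<in>{Suc n..<M}. level_height f m) / 2 + e"
      and "y - ((1 - w) * a + w * b) = v * (2 * c - a - b)" "0 \<le> v" "v \<le> 1 / 2" for v y
  proof -
    have "\<bar>v * (2 * c - a - b)\<bar> \<le> 1 / 2 * level_height f n"
      unfolding abs_mult using that(3,4) half by (intro mult_mono) auto
    then show ?thesis using that(1,2) sum_eq by linarith
  qed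
  show ?case
  proof (cases "w \<le> 1 / 2")
    case True
    have "\<bar>f x - ((1 - (2 ^ Suc n * x - real (2 * k))) * f (dyadic_point (Suc n) (2 * k))
        + (2 ^ Suc n * x - real (2 * k)) * f (dyadic_point (Suc n) (2 * k + 1)))\<bar>
      \<le> (\<Sum>m\<in>{Suc n..<M}. level_height f m) / 2 + e"
      using step.prems True by (intro step.IH) (auto simp: w_def)
    moreover have "2 ^ Suc n * x - real (2 * k) = 2 * w" by (simp add: w_def)
    ultimately have "\<bar>f x - ((1 - 2 * w) * a + 2 * w * c)\<bar>
        \<le> (\<Sum>m\<in>{Suc n..<M}. level_height f m) / 2 + e"
      by (simp add: a_def c_def)
    then have "\<bar>f x - ((1 - w) * a + w * b)\<bar> \<le> (\<Sum>m\<in>{n..<M}. level_height f m) / 2 + e"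
      by (rule close_half[where v = w]) (use w True in \<open>auto simp: algebra_simps\<close>)
    then show ?thesis by (simp add: a_def b_def w_def)
  next
    case False
    have "\<bar>f x - ((1 - (2 ^ Suc n * x - real (2 * k + 1))) * f (dyadic_point (Suc n) (2 * k + 1))
        + (2 ^ Suc n * x - real (2 * k + 1)) * f (dyadic_point (Suc n) (2 * k + 1 + 1)))\<bar>
      \<le> (\<Sum>m\<in>{Suc n..<M}. level_height f m) / 2 + e"
      using step.prems False by (intro step.IH) (auto simp: w_def)
    moreover have "2 ^ Suc n * x - real (2 * k + 1) = 2 * w - 1" by (simp add: w_def)
    moreover have "dyadic_point (Suc n) (2 * k + 1 + 1) = dyadic_point n (k + 1)" by simp
    ultimately have "\<bar>f x - ((1 - (2 * w - 1)) * c + (2 * w - 1) * b)\<bar>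
        \<le> (\<Sum>m\<in>{Suc n..<M}. level_height f m) / 2 + e"
      by (simp only: b_def c_def)
    then have "\<bar>f x - ((1 - w) * a + w * b)\<bar> \<le> (\<Sum>m\<in>{n..<M}. level_height f m) / 2 + e"
      by (rule close_half[where v = "1 - w"]) (use w False in \<open>auto simp: algebra_simps\<close>)
    then show ?thesis by (simp add: a_def b_def w_def)
  qed
qed

text \<open>The tail enters with the factor \<open>1/2\<close> because at a midpoint the function deviates from the secant by
  half the second difference.\<close>

definition oscillation_bound :: "real \<Rightarrow> (real \<Rightarrow> real) \<Rightarrow> nat \<Rightarrow> real" where
  "oscillation_bound p f n = energy_average p f n + enn2real (schauder_tail f n) / 2"

lemma interpolation_error_tail:
  assumes cont: "continuous_on {0..1} f" and fin: "schauder_tail f n < \<infinity>"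
    and x: "k < 2 ^ n" "real k \<le> 2 ^ n * x" "2 ^ n * x \<le> real k + 1"
  shows "\<bar>f x - ((1 - (2 ^ n * x - real k)) * f (dyadic_point n k)
      + (2 ^ n * x - real k) * f (dyadic_point n (k + 1)))\<bar> \<le> enn2real (schauder_tail f n) / 2"
proof (rule field_le_epsilon)
  fix e :: real
  assume "0 < e"
  moreover have "uniformly_continuous_on {0..1} f"
    using cont by (intro compact_uniformly_continuous) auto
  ultimately obtain d where d: "0 < d"
      "\<And>y z. y \<in> {0..1} \<Longrightarrow> z \<in> {0..1} \<Longrightarrow> dist z y < d \<Longrightarrow> dist (f z) (f y) < e"
    unfolding uniformly_continuous_on_def by blast
  obtain M0 where "(1 / 2) ^ M0 < d"
    using real_arch_pow_inv[OF d(1), of "1 / 2"] by auto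
  moreover define M where "M = max n M0"
  moreover have "(1 / 2 :: real) ^ M \<le> (1 / 2) ^ M0"
    by (intro power_decreasing) (auto simp: M_def)
  ultimately have M: "n \<le> M" "1 / 2 ^ M < d"
    by (auto simp: power_divide)
  have "\<bar>f y - f z\<bar> \<le> e" if "y \<in> {0..1}" "z \<in> {0..1}" "\<bar>y - z\<bar> \<le> 1 / 2 ^ M" for y z
    using d(2)[of z y] that M by (simp add: dist_real_def)
  then have "\<bar>f x - ((1 - (2 ^ n * x - real k)) * f (dyadic_point n k)
      + (2 ^ n * x - real k) * f (dyadic_point n (k + 1)))\<bar>
    \<le> (\<Sum>m\<in>{n..<M}. level_height f m) / 2 + e"
    by (intro interpolation_error M(1) x)
  with level_height_sum_le_tail[OF fin, of M]
  show "\<bar>f x - ((1 - (2 ^ n * x - real k)) * f (dyadic_point n k)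
      + (2 ^ n * x - real k) * f (dyadic_point n (k + 1)))\<bar> \<le> enn2real (schauder_tail f n) / 2 + e"
    by linarith
qed

text \<open>The secant differs from its value at an endpoint by at most one increment, and a single
  increment is bounded by the \<open>\<ell>\<^sup>p\<close> norm of all increments of its level.\<close>

lemma endpoint_oscillation_bound:
  assumes p: "1 < p" and cont: "continuous_on {0..1} f" and fin: "\<And>n. schauder_tail f n < \<infinity>"
  shows "endpoint_oscillation f (oscillation_bound p f)"
  unfolding endpoint_oscillation_def
proof (intro allI impI)
  fix n k x
  assume k: "k < (2::nat) ^ n" and x: "x \<in> {dyadic_point n k..dyadic_point n (k + 1)}"
  define w where "w = 2 ^ n * x - real k"
  have ord: "real k \<le> 2 ^ n * x" "2 ^ n * x \<le> real k + 1"
    using x by (auto simp: dyadic_point_def divide_le_eq le_divide_eq mult.commute add.commute)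
  then have w: "0 \<le> w" "w \<le> 1" by (auto simp: w_def)
  define a b where "a = f (dyadic_point n k)" and "b = f (dyadic_point n (k + 1))"
  have E: "\<bar>f x - ((1 - w) * a + w * b)\<bar> \<le> enn2real (schauder_tail f n) / 2"
    using interpolation_error_tail[OF cont fin k ord] by (simp add: w_def a_def b_def)
  have "\<bar>b - a\<bar> \<le> energy_average p f n"
    using component_le_finite_lp_norm[OF p, of "{..<2 ^ n}" k "dyadic_increment f n"] k
      increment_norm_le[OF p, of n f] by (simp add: dyadic_increment_def a_def b_def)
  then have "w * \<bar>b - a\<bar> \<le> 1 * energy_average p f n" "(1 - w) * \<bar>b - a\<bar> \<le> 1 * energy_average p f n"
    using w by (intro mult_mono; simp)+
  then have "\<bar>w * (b - a)\<bar> \<le> energy_average p f n" "\<bar>(1 - w) * (b - a)\<bar> \<le> energy_average p f n"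
    using w by (simp_all add: abs_mult)
  moreover have "f x - a = (f x - ((1 - w) * a + w * b)) + w * (b - a)"
    "f x - b = (f x - ((1 - w) * a + w * b)) - (1 - w) * (b - a)"
    by (simp_all add: algebra_simps)
  ultimately show "\<bar>f x - f (dyadic_point n k)\<bar> \<le> oscillation_bound p f n \<and>
      \<bar>f x - f (dyadic_point n (k + 1))\<bar> \<le> oscillation_bound p f n"
    using E unfolding oscillation_bound_def a_def[symmetric] b_def[symmetric] by linarith
qed

text \<open>The intervals counted are only half of those on level \<open>n + 1\<close>.\<close>

lemma half_increment_norms_le:
  assumes p: "1 < p"
  shows "finite_lp_norm p {..<2 ^ n} (\<lambda>k. dyadic_increment f (Suc n) (2 * k)) \<le> oscillation_bound p f n"
    and "finite_lp_norm p {..<2 ^ n} (\<lambda>k. dyadic_increment f (Suc n) (2 * k + 1)) \<le> oscillation_bound p f n"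
proof -
  define D where "D = finite_lp_norm p {..<2 ^ Suc n} (dyadic_increment f (Suc n))"
  have total: "D powr p = (\<Sum>k<2 ^ n. \<bar>dyadic_increment f (Suc n) (2 * k)\<bar> powr p
      + \<bar>dyadic_increment f (Suc n) (2 * k + 1)\<bar> powr p)"
    unfolding D_def finite_lp_norm_powr[OF p] power_Suc sum_double_lessThan ..
  have D0: "0 \<le> D" by (simp add: D_def)
  have D: "D \<le> oscillation_bound p f n"
    using increment_norm_Suc_le[OF p, of n f]
    by (simp add: D_def oscillation_bound_def add_increasing2)
  have "finite_lp_norm p {..<2 ^ n} (\<lambda>k. dyadic_increment f (Suc n) (2 * k)) \<le> D"
    by (intro finite_lp_norm_leI p D0) (simp add: total sum_mono)
  then show "finite_lp_norm p {..<2 ^ n} (\<lambda>k. dyadic_increment f (Suc n) (2 * k)) \<le> oscillation_bound p f n"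
    using D by linarith
  have "finite_lp_norm p {..<2 ^ n} (\<lambda>k. dyadic_increment f (Suc n) (2 * k + 1)) \<le> D"
    by (intro finite_lp_norm_leI p D0) (simp add: total sum_mono)
  then show "finite_lp_norm p {..<2 ^ n} (\<lambda>k. dyadic_increment f (Suc n) (2 * k + 1)) \<le> oscillation_bound p f n"
    using D by linarith
qed

lemma oscillation_bound_nonneg [simp]: "0 \<le> oscillation_bound p f n"
  by (simp add: oscillation_bound_def)

text \<open>Left halves for \<open>f\<close> and right halves for \<open>g\<close> are paired by Hoelder on level \<open>n + 1\<close>.\<close>

lemma area_sum_le:
  assumes pq: "1 < p" "1 < q" "1 / p + 1 / q = 1" and L: "L \<le> 2 ^ n"
  shows "\<bar>\<Sum>k\<in>{K..<L}. area_increment f g n k\<bar> \<le> oscillation_bound p f n * oscillation_bound q g n"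
proof -
  let ?a = "\<lambda>k. dyadic_increment f (Suc n) (2 * k)"
  let ?b = "\<lambda>k. dyadic_increment g (Suc n) (2 * k + 1)"
  have "\<bar>\<Sum>k\<in>{K..<L}. area_increment f g n k\<bar> \<le> (\<Sum>k\<in>{K..<L}. \<bar>?a k\<bar> * \<bar>?b k\<bar>)"
    unfolding area_increment_def abs_mult[symmetric] by (rule sum_abs)
  also have "\<dots> \<le> (\<Sum>k<2 ^ n. \<bar>?a k\<bar> * \<bar>?b k\<bar>)"
    using L by (intro sum_mono2) auto
  also have "\<dots> \<le> finite_lp_norm p {..<2 ^ n} ?a * finite_lp_norm q {..<2 ^ n} ?b"
    by (intro finite_holder pq) simp
  also have "\<dots> \<le> oscillation_bound p f n * oscillation_bound q g n"
    by (intro mult_mono half_increment_norms_le pq) simp_all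
  finally show ?thesis .
qed

text \<open>Minkowski's inequality for the two summands, on finitely many levels.\<close>

lemma oscillation_bound_norm_le_FS_bound:
  assumes p: "1 < p" and fin: "\<And>n. schauder_tail f n < \<infinity>" and F: "finite F" "F \<subseteq> {N..}"
  shows "ennreal (finite_lp_norm p F (oscillation_bound p f)) \<le> FS_bound p f N"
proof -
  define h where "h n = enn2real (schauder_tail f n)" for n
  have h: "schauder_tail f = (\<lambda>n. ennreal \<bar>h n\<bar>)"
    using fin by (simp add: h_def fun_eq_iff)
  have "finite_lp_norm p F (oscillation_bound p f)
      \<le> finite_lp_norm p F (energy_average p f) + finite_lp_norm p F h / 2"
    using finite_minkowski[OF p F(1), of "energy_average p f" "\<lambda>n. h n / 2"]
    by (simp add: finite_lp_norm_half[OF p] oscillation_bound_def[abs_def] h_def[abs_def])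
  then have "ennreal (finite_lp_norm p F (oscillation_bound p f))
      \<le> ennreal (finite_lp_norm p F (energy_average p f)) + ennreal (finite_lp_norm p F h) / 2"
    by (simp add: ennreal_leI divide_ennreal flip: ennreal_plus ennreal_numeral)
  also have "\<dots> \<le> FS_bound p f N"
    unfolding FS_bound_def h
    by (intro add_mono divide_right_mono_ennreal ennreal_finite_lp_norm_le p F)
  finally show ?thesis .
qed

lemma schauder_tail_summable:
  assumes p: "1 < p" and lp: "in_lp UNIV p (schauder_tail f)"
  shows "summable (\<lambda>n. enn2real (schauder_tail f n) powr p)"
proof -
  have "schauder_tail f = (\<lambda>n. ennreal \<bar>enn2real (schauder_tail f n)\<bar>)"
    using in_lp_finite[OF p lp] by (simp add: fun_eq_iff)
  then have "in_lp UNIV p (\<lambda>n. ennreal \<bar>enn2real (schauder_tail f n)\<bar>)"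
    using lp by simp
  from in_lp_imp_summable[OF p this, of id] show ?thesis by simp
qed

lemma oscillation_bound_summable:
  assumes p: "1 < p" and "in_lp {-1..} p (\<lambda>n. ennreal \<bar>level_energy p f n\<bar>)"
    and "in_lp UNIV p (schauder_tail f)"
  shows "summable (\<lambda>n. oscillation_bound p f n powr p)"
proof (rule summable_comparison_test'[where N = 0])
  let ?h = "\<lambda>n. enn2real (schauder_tail f n)"
  show "summable (\<lambda>n. 2 powr p * (energy_average p f n powr p + ?h n powr p))"
    by (intro summable_mult summable_add energy_average_summable schauder_tail_summable assms)
  fix n
  have "oscillation_bound p f n \<le> 2 * max (energy_average p f n) (?h n)"
    using enn2real_nonneg[of "schauder_tail f n"] energy_average_nonneg[of p f n]
    unfolding oscillation_bound_def by linarith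
  then have "oscillation_bound p f n powr p \<le> (2 * max (energy_average p f n) (?h n)) powr p"
    using p by (intro powr_mono2) auto
  also have "\<dots> \<le> 2 powr p * (energy_average p f n powr p + ?h n powr p)"
    by (auto simp: powr_mult max_def)
  finally show "norm (oscillation_bound p f n powr p)
      \<le> 2 powr p * (energy_average p f n powr p + ?h n powr p)" by simp
qed

section \<open>The Faber--Schauder integral\<close>

theorem theorem3p18:
  fixes p q :: real and f g :: "real \<Rightarrow> real"
  assumes "p > 1" and "q > 1" and "1 / p + 1 / q = 1"
    and "continuous_on {0..1} f" and "continuous_on {0..1} g"
    and "in_lp {-1..} p (\<lambda>n. ennreal \<bar>level_energy p f n\<bar>)"
    and "in_lp {-1..} q (\<lambda>n. ennreal \<bar>level_energy q g n\<bar>)"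
    and "in_lp UNIV p (schauder_tail f)"
    and "in_lp UNIV q (schauder_tail g)"
  shows "FS_integrable f g \<and>
    (\<forall>s \<xi> t. \<forall>N::nat. 0 \<le> s \<and> s \<le> \<xi> \<and> \<xi> \<le> t \<and> t \<le> 1 \<and> t - s \<le> 1 / 2 ^ N \<longrightarrow>
       ennreal \<bar>FS_int_between f g s t - f \<xi> * (g t - g s)\<bar>
         \<le> 8 * FS_bound p f N * FS_bound q g N) \<and>
    (\<forall>s \<xi> t. 0 \<le> s \<and> s \<le> \<xi> \<and> \<xi> \<le> t \<and> t \<le> 1 \<longrightarrow>
       ennreal \<bar>FS_int_between f g s t - f \<xi> * (g t - g s)\<bar>
         \<le> 8 * FS_bound p f 0 * FS_bound q g 0)"
proof -
  note pq = assms(1-3)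
  define B where "B = oscillation_bound p f"
  define C where "C = oscillation_bound q g"
  have fin: "schauder_tail f n < \<infinity>" "schauder_tail g n < \<infinity>" for n
    using in_lp_finite[OF pq(1) assms(8)] in_lp_finite[OF pq(2) assms(9)] by simp_all
  \<comment> \<open>Young's inequality makes the products \<open>B n * C n\<close> summable\<close>
  have "summable (\<lambda>n. B n powr p / p + C n powr q / q)"
    unfolding B_def C_def
    by (intro summable_add[OF summable_divide summable_divide]
        oscillation_bound_summable[OF pq(1) assms(6,8)]
        oscillation_bound_summable[OF pq(2) assms(7,9)])
  moreover have "norm (B n * C n) \<le> B n powr p / p + C n powr q / q" for n
    using Youngs_inequality[OF pq, of "B n" "C n"] by (simp add: B_def C_def)
  ultimately have "summable (\<lambda>n. B n * C n)"
    by (rule summable_comparison_test'[where N = 0])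
  then interpret controlled_pair f g B C
    unfolding B_def C_def
    using endpoint_oscillation_bound[OF pq(1) assms(4) fin(1)]
      endpoint_oscillation_bound[OF pq(2) assms(5) fin(2)] area_sum_le[OF pq] assms(4,5)
    by (intro controlled_pair.intro)
  have tail_le: "ennreal (tail N) \<le> FS_bound p f N * FS_bound q g N" for N
  proof (rule LIMSEQ_le_const2)
    show "(\<lambda>M. ennreal (\<Sum>n<M. B (n + N) * C (n + N))) \<longlonglongrightarrow> ennreal (tail N)"
      unfolding tail_def by (intro tendsto_ennrealI summable_LIMSEQ summable_shift)
    have "ennreal (\<Sum>n<M. B (n + N) * C (n + N)) \<le> FS_bound p f N * FS_bound q g N" for M
    proof -
      have "(\<Sum>n<M. B (n + N) * C (n + N)) = (\<Sum>n\<in>{N..<M + N}. \<bar>B n\<bar> * \<bar>C n\<bar>)"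
        using sum.shift_bounds_nat_ivl[of "\<lambda>n. B n * C n" 0 N M] by (simp add: lessThan_atLeast0)
      also have "\<dots> \<le> finite_lp_norm p {N..<M + N} B * finite_lp_norm q {N..<M + N} C"
        by (intro finite_holder pq) simp
      finally have "ennreal (\<Sum>n<M. B (n + N) * C (n + N))
          \<le> ennreal (finite_lp_norm p {N..<M + N} B) * ennreal (finite_lp_norm q {N..<M + N} C)"
        by (simp add: ennreal_leI flip: ennreal_mult)
      also have "\<dots> \<le> FS_bound p f N * FS_bound q g N"
        unfolding B_def C_def
        by (intro mult_mono oscillation_bound_norm_le_FS_bound pq fin) auto
      finally show ?thesis .
    qed
    then show "\<exists>M0. \<forall>M\<ge>M0. ennreal (\<Sum>n<M. B (n + N) * C (n + N)) \<le> FS_bound p f N * FS_bound q g N"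
      by blast
  qed
  have bound: "ennreal \<bar>FS_int_between f g s t - f \<xi> * (g t - g s)\<bar> \<le> 8 * FS_bound p f N * FS_bound q g N"
    if "0 \<le> s" "s \<le> \<xi>" "\<xi> \<le> t" "t \<le> 1" "t - s \<le> 1 / 2 ^ N" for s \<xi> t N
  proof -
    have "\<bar>FS_int_between f g s t - f \<xi> * (g t - g s)\<bar> \<le> 8 * tail N"
      using primitive_estimate[OF that] that by (simp add: FS_int_between_def FS_integral_eq_primitive)
    then have "ennreal \<bar>FS_int_between f g s t - f \<xi> * (g t - g s)\<bar> \<le> ennreal (8 * tail N)"
      by (rule ennreal_leI)
    also have "\<dots> = 8 * ennreal (tail N)"
      by (simp add: ennreal_mult')
    also have "\<dots> \<le> 8 * (FS_bound p f N * FS_bound q g N)"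
      by (intro mult_left_mono tail_le) simp
    finally show ?thesis by (simp add: mult.assoc)
  qed
  have "FS_integrable f g"
    unfolding FS_integrable_def using is_FS_integral_primitive by blast
  moreover have "t - s \<le> 1 / 2 ^ 0" if "0 \<le> s" "t \<le> 1" for s t :: real
    using that by simp
  ultimately show ?thesis
    using bound by blast
qed

end
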